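(* Let $\Psi:\mathrm{QSym}\to\mathrm{QSym}$ be the linear map with $\Psi(F_\alpha)=F_{\alpha^c}$ for every composition $\alpha$. Then $\Psi$ is the unique nontrivial (i.e. non-identity) graded coalgebra automorphism of $\mathrm{QSym}$ that takes the fundamental basis $\{F_\alpha:\alpha\in\mathcal{C}\}$ onto itself.
   Context: A composition is a finite (possibly empty) ordered list $\alpha=(\alpha_1,\dots,\alpha_k)$ of positive integers; $|\alpha|=\alpha_1+\cdots+\alpha_k$, and $\mathcal{C}$ is the set of all compositions ($\emptyset$ is the empty one). For a composition $\alpha$ of $n\ge1$ let $\mathrm{Set}(\alpha)=\{\alpha_1,\alpha_1+\alpha_2,\dots,\alpha_1+\cdots+\alpha_{k-1}\}\subseteq\{1,\dots,n-1\}$; this is a bijection between compositions of $n$ and subsets of $\{1,\dots,n-1\}$. The complement $\alpha^c$ is the composition of $n$ with $\mathrm{Set}(\alpha^c)=\{1,\dots,n-1\}\setminus\mathrm{Set}(\alpha)$, and $\emptyset^c=\emptyset$. $\mathrm{QSym}$ is the set of bounded-degree formal power series $f\in\mathbb{Q}[[x_1,x_2,\dots]]$ such that for each composition $(\alpha_1,\dots,\alpha_k)$ all monomials $x_{i_1}^{\alpha_1}\cdots x_{i_k}^{\alpha_k}$ with $i_1<\cdots<i_k$ have the same coefficient in $f$. Let $M_\emptyset=1$, $M_\alpha=\sum_{i_1<\cdots<i_k}x_{i_1}^{\alpha_1}\cdots x_{i_k}^{\alpha_k}$. Write $\beta\preceq\alpha$ if $\alpha$ is obtained from $\beta$ by summing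 some consecutive parts of $\beta$. The fundamental basis is $F_\emptyset=1$, $F_\alpha=\sum_{\beta\preceq\alpha}M_\beta$. $\mathrm{QSym}=\bigoplus_{n\ge0}\mathrm{QSym}_n$ with $\mathrm{QSym}_n=\mathrm{span}\{F_\alpha:|\alpha|=n\}$ is a graded coalgebra over $\mathbb{Q}$ with coproduct $\Delta(M_\alpha)=\sum_{\alpha=\beta\cdot\gamma}M_\beta\otimes M_\gamma$ (all deconcatenations, empty compositions allowed), equivalently $\Delta(F_\alpha)=\sum_{\alpha=\beta\cdot\gamma}F_\beta\otimes F_\gamma+\sum_{\alpha=\beta\odot\gamma}F_\beta\otimes F_\gamma$, where $\beta\cdot\gamma$ is concatenation and, for nonempty $\beta=(\beta_1,\dots,\beta_p)$ and $\gamma=(\gamma_1,\dots,\gamma_q)$, $\beta\odot\gamma=(\beta_1,\dots,\beta_{p-1},\beta_p+\gamma_1,\gamma_2,\dots,\gamma_q)$ is near concatenation. The counit satisfies $\varepsilon(F_\emptyset)=1$, $\varepsilon(F_\alpha)=0$ for $\alpha\ne\emptyset$. A map is graded if it maps $\mathrm{QSym}_n$ into $\mathrm{QSym}_n$ for all $n$. *)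

theory Defs
  imports Complex_Main "HOL-Library.Poly_Mapping"
begin

section \<open>Rational vector spaces and their tensor products\<close>

class rat_vector = ab_group_add +
  fixes scaleQ :: "rat \<Rightarrow> 'a \<Rightarrow> 'a"  (infixr \<open>*\<^sub>Q\<close> 75)
  assumes scaleQ_add_right: "a *\<^sub>Q (x + y) = a *\<^sub>Q x + a *\<^sub>Q y"
    and scaleQ_add_left: "(a + b) *\<^sub>Q x = a *\<^sub>Q x + b *\<^sub>Q x"
    and scaleQ_scaleQ: "a *\<^sub>Q b *\<^sub>Q x = (a * b) *\<^sub>Q x"
    and scaleQ_one: "1 *\<^sub>Q x = x"

global_interpretation ratvec: vector_space "scaleQ :: rat \<Rightarrow> 'a \<Rightarrow> 'a :: rat_vector"
  by unfold_locales
     (simp_all add: scaleQ_add_right scaleQ_add_left scaleQ_scaleQ scaleQ_one)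

abbreviation linearQ :: "('a::rat_vector \<Rightarrow> 'b::rat_vector) \<Rightarrow> bool"
  where "linearQ \<equiv> Vector_Spaces.linear scaleQ scaleQ"

lemma linearQ_I:
  assumes "\<And>x y. f (x + y) = f x + f y" "\<And>c x. f (c *\<^sub>Q x) = c *\<^sub>Q f x"
  shows "linearQ f"
  by (simp add: Vector_Spaces.linear_iff assms ratvec.vector_space_axioms)

instantiation rat :: rat_vector
begin

definition scaleQ_rat :: "rat \<Rightarrow> rat \<Rightarrow> rat"
  where "scaleQ_rat a x = a * x"

instance
  by standard (simp_all add: scaleQ_rat_def algebra_simps)

end

text \<open>Finitely supported functions \<open>'k \<Rightarrow>\<^sub>0 rat\<close> form the free rational vector space on \<open>'k\<close>.\<close>

definition free_scale :: "rat \<Rightarrow> ('k \<Rightarrow>\<^sub>0 rat) \<Rightarrow> ('k \<Rightarrow>\<^sub>0 rat)"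
  where "free_scale c p = Poly_Mapping.map ((*) c) p"

lemma lookup_free_scale [simp]: "Poly_Mapping.lookup (free_scale c p) k = c * Poly_Mapping.lookup p k"
  by (cases "Poly_Mapping.lookup p k = 0") (simp_all add: free_scale_def Poly_Mapping.map.rep_eq)

global_interpretation free: vector_space "free_scale :: rat \<Rightarrow> ('k \<Rightarrow>\<^sub>0 rat) \<Rightarrow> _"
  by unfold_locales (auto intro!: poly_mapping_eqI simp: lookup_add algebra_simps)

definition bilinear_relations :: "('a::rat_vector \<times> 'b::rat_vector \<Rightarrow>\<^sub>0 rat) set"
  where "bilinear_relations =
      {Poly_Mapping.single (u + v, w) 1 - Poly_Mapping.single (u, w) 1
          - Poly_Mapping.single (v, w) 1 | u v w. True}
    \<union> {Poly_Mapping.single (u, v + w) 1 - Poly_Mapping.single (u, v) 1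
          - Poly_Mapping.single (u, w) 1 | u v w. True}
    \<union> {Poly_Mapping.single (c *\<^sub>Q u, v) 1 - Poly_Mapping.single (u, v) c | c u v. True}
    \<union> {Poly_Mapping.single (u, c *\<^sub>Q v) 1 - Poly_Mapping.single (u, v) c | c u v. True}"

definition tensor_rel ::
    "('a::rat_vector \<times> 'b::rat_vector \<Rightarrow>\<^sub>0 rat) \<Rightarrow> ('a \<times> 'b \<Rightarrow>\<^sub>0 rat) \<Rightarrow> bool"
  where "tensor_rel p q \<longleftrightarrow> p - q \<in> free.span bilinear_relations"

lemma equivp_tensor_rel:
  "equivp (tensor_rel :: ('a::rat_vector \<times> 'b::rat_vector \<Rightarrow>\<^sub>0 rat) \<Rightarrow> _)"
proof (rule equivpI)
  show "reflp (tensor_rel :: ('a \<times> 'b \<Rightarrow>\<^sub>0 rat) \<Rightarrow> _)"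
    by (auto intro!: reflpI simp: tensor_rel_def free.span_zero)
  show "symp (tensor_rel :: ('a \<times> 'b \<Rightarrow>\<^sub>0 rat) \<Rightarrow> _)"
  proof (rule sympI)
    fix p q :: "'a \<times> 'b \<Rightarrow>\<^sub>0 rat"
    assume "tensor_rel p q"
    then have "- (p - q) \<in> free.span bilinear_relations"
      unfolding tensor_rel_def by (rule free.span_neg)
    then show "tensor_rel q p" by (simp add: tensor_rel_def)
  qed
  show "transp (tensor_rel :: ('a \<times> 'b \<Rightarrow>\<^sub>0 rat) \<Rightarrow> _)"
  proof (rule transpI)
    fix p q r :: "'a \<times> 'b \<Rightarrow>\<^sub>0 rat"
    assume "tensor_rel p q" "tensor_rel q r"
    then have "(p - q) + (q - r) \<in> free.span bilinear_relations"
      unfolding tensor_rel_def by (rule free.span_add)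
    then show "tensor_rel p r" by (simp add: tensor_rel_def)
  qed
qed

quotient_type (overloaded) ('a, 'b) tensor =
    "'a::rat_vector \<times> 'b::rat_vector \<Rightarrow>\<^sub>0 rat" / tensor_rel
  by (rule equivp_tensor_rel)

instantiation tensor :: (rat_vector, rat_vector) rat_vector
begin

lift_definition zero_tensor :: "('a, 'b) tensor" is 0 .

lift_definition plus_tensor :: "('a, 'b) tensor \<Rightarrow> ('a, 'b) tensor \<Rightarrow> ('a, 'b) tensor" is "(+)"
proof -
  fix p p' q q' :: "'a \<times> 'b \<Rightarrow>\<^sub>0 rat"
  assume "tensor_rel p p'" "tensor_rel q q'"
  then have "(p - p') + (q - q') \<in> free.span bilinear_relations"
    unfolding tensor_rel_def by (rule free.span_add)
  then show "tensor_rel (p + q) (p' + q')"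
    by (simp add: tensor_rel_def algebra_simps)
qed

lift_definition uminus_tensor :: "('a, 'b) tensor \<Rightarrow> ('a, 'b) tensor" is uminus
proof -
  fix p p' :: "'a \<times> 'b \<Rightarrow>\<^sub>0 rat"
  assume "tensor_rel p p'"
  then have "- (p - p') \<in> free.span bilinear_relations"
    unfolding tensor_rel_def by (rule free.span_neg)
  then show "tensor_rel (- p) (- p')"
    by (simp add: tensor_rel_def algebra_simps)
qed

definition minus_tensor :: "('a, 'b) tensor \<Rightarrow> ('a, 'b) tensor \<Rightarrow> ('a, 'b) tensor"
  where "minus_tensor s t = s + (- t)"

lift_definition scaleQ_tensor :: "rat \<Rightarrow> ('a, 'b) tensor \<Rightarrow> ('a, 'b) tensor" is free_scale
proof -
  fix c and p p' :: "'a \<times> 'b \<Rightarrow>\<^sub>0 rat"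
  assume "tensor_rel p p'"
  then have "free_scale c (p - p') \<in> free.span bilinear_relations"
    unfolding tensor_rel_def by (rule free.span_scale)
  then show "tensor_rel (free_scale c p) (free_scale c p')"
    by (simp add: tensor_rel_def free.scale_right_diff_distrib)
qed

instance
proof
  fix a b c :: "('a, 'b) tensor" and x y :: rat
  have eqI: "tensor_rel p q" if "p = q" for p q :: "'a \<times> 'b \<Rightarrow>\<^sub>0 rat"
    using that by (simp add: tensor_rel_def free.span_zero)
  show "a + b + c = a + (b + c)" by transfer (rule eqI, simp add: add.assoc)
  show "a + b = b + a" by transfer (rule eqI, simp add: add.commute)
  show "0 + a = a" by transfer (rule eqI, simp)
  show "- a + a = 0" by transfer (rule eqI, simp)
  show "a - b = a + - b" by (rule minus_tensor_def)
  show "x *\<^sub>Q (a + b) = x *\<^sub>Q a + x *\<^sub>Q b"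
    by transfer (rule eqI, rule free.scale_right_distrib)
  show "(x + y) *\<^sub>Q a = x *\<^sub>Q a + y *\<^sub>Q a"
    by transfer (rule eqI, rule free.scale_left_distrib)
  show "x *\<^sub>Q y *\<^sub>Q a = (x * y) *\<^sub>Q a"
    by transfer (rule eqI, rule free.scale_scale)
  show "1 *\<^sub>Q a = a" by transfer (rule eqI, rule free.scale_one)
qed

end

lift_definition tensor_prod :: "'a::rat_vector \<Rightarrow> 'b::rat_vector \<Rightarrow> ('a, 'b) tensor"
    (infixr \<open>\<otimes>\<close> 76)
  is "\<lambda>u v. Poly_Mapping.single (u, v) 1" .

text \<open>
  The map \<open>f \<otimes> g\<close>, evaluated on a chosen representative \<open>\<Sum> c (u \<otimes> v)\<close> of the tensor. For linear
  \<open>f\<close> and \<open>g\<close> the choice is immaterial; see \<open>tensor_map_prod\<close> and \<open>linear_tensor_map\<close> below.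
\<close>

definition tensor_map ::
    "('a::rat_vector \<Rightarrow> 'c::rat_vector) \<Rightarrow> ('b::rat_vector \<Rightarrow> 'd::rat_vector)
      \<Rightarrow> ('a, 'b) tensor \<Rightarrow> ('c, 'd) tensor"
  where "tensor_map f g t =
    (\<Sum>k \<in> Poly_Mapping.keys (rep_tensor t).
      Poly_Mapping.lookup (rep_tensor t) k *\<^sub>Q (f (fst k) \<otimes> g (snd k)))"

lemma tensor_prod_add_left: "(u + v) \<otimes> w = u \<otimes> w + v \<otimes> w"
  apply transfer
  unfolding tensor_rel_def bilinear_relations_def diff_diff_eq[symmetric]
  by (rule free.span_base) blast

lemma tensor_prod_add_right: "u \<otimes> (v + w) = u \<otimes> v + u \<otimes> w"
  apply transfer
  unfolding tensor_rel_def bilinear_relations_def diff_diff_eq[symmetric]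
  by (rule free.span_base) blast

lemma free_scale_single: "free_scale c (Poly_Mapping.single k x) = Poly_Mapping.single k (c * x)"
  by (auto intro!: poly_mapping_eqI simp: lookup_single when_def)

lemma tensor_prod_scale_left: "(c *\<^sub>Q u) \<otimes> v = c *\<^sub>Q (u \<otimes> v)"
  apply transfer
  unfolding tensor_rel_def bilinear_relations_def free_scale_single mult_1_right
  by (rule free.span_base) blast

lemma tensor_prod_scale_right: "u \<otimes> (c *\<^sub>Q v) = c *\<^sub>Q (u \<otimes> v)"
  apply transfer
  unfolding tensor_rel_def bilinear_relations_def free_scale_single mult_1_right
  by (rule free.span_base) blast

definition free_extend :: "('k \<Rightarrow> 'c::rat_vector) \<Rightarrow> ('k \<Rightarrow>\<^sub>0 rat) \<Rightarrow> 'c"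
  where "free_extend b p = (\<Sum>k \<in> Poly_Mapping.keys p. Poly_Mapping.lookup p k *\<^sub>Q b k)"

lemma free_extend_superset:
  assumes "finite S" "Poly_Mapping.keys p \<subseteq> S"
  shows "free_extend b p = (\<Sum>k \<in> S. Poly_Mapping.lookup p k *\<^sub>Q b k)"
  unfolding free_extend_def
  by (rule sum.mono_neutral_left) (use assms in \<open>auto simp: in_keys_iff\<close>)

lemma free_extend_add: "free_extend b (p + q) = free_extend b p + free_extend b q"
proof -
  let ?S = "Poly_Mapping.keys p \<union> Poly_Mapping.keys q"
  have "Poly_Mapping.keys (p + q) \<subseteq> ?S" by (rule Poly_Mapping.keys_add)
  then show ?thesis
    using free_extend_superset[of ?S "p + q" b] free_extend_superset[of ?S p b]
      free_extend_superset[of ?S q b]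
    by (simp add: lookup_add ratvec.scale_left_distrib sum.distrib)
qed

lemma free_extend_scale: "free_extend b (free_scale c p) = c *\<^sub>Q free_extend b p"
proof -
  have "Poly_Mapping.keys (free_scale c p) \<subseteq> Poly_Mapping.keys p" by (auto simp: in_keys_iff)
  then show ?thesis
    using free_extend_superset[of "Poly_Mapping.keys p" "free_scale c p" b]
      free_extend_superset[of "Poly_Mapping.keys p" p b]
    by (simp add: ratvec.scale_sum_right)
qed

lemma free_extend_diff: "free_extend b (p - q) = free_extend b p - free_extend b q"
  using free_extend_add[of b "p - q" q] by (simp add: algebra_simps)

lemma free_extend_single: "free_extend b (Poly_Mapping.single k c) = c *\<^sub>Q b k"
  by (cases "c = 0") (simp_all add: free_extend_def)

lemma free_extend_respects:
  assumes add_left: "\<And>u v w. b (u + v, w) = b (u, w) + b (v, w)"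
    and add_right: "\<And>u v w. b (u, v + w) = b (u, v) + b (u, w)"
    and scale_left: "\<And>c u v. b (c *\<^sub>Q u, v) = c *\<^sub>Q b (u, v)"
    and scale_right: "\<And>c u v. b (u, c *\<^sub>Q v) = c *\<^sub>Q b (u, v)"
    and "tensor_rel p q"
  shows "free_extend b p = free_extend b q"
proof -
  have rels: "r \<in> bilinear_relations \<Longrightarrow> free_extend b r = 0" for r
    unfolding bilinear_relations_def
    by (elim UnE CollectE exE conjE)
       (simp_all add: free_extend_diff free_extend_single add_left add_right scale_left scale_right)
  have diff: "p - q \<in> free.span bilinear_relations"
    using \<open>tensor_rel p q\<close> by (simp add: tensor_rel_def)
  have "free_extend b (p - q) = 0"
    using diff
    by (induction rule: free.span_induct_alt)
       (simp_all add: free_extend_def[of b 0] free_extend_add free_extend_scale rels)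
  then show ?thesis by (simp add: free_extend_diff)
qed

lemma tensor_map_abs:
  assumes "linearQ f" "linearQ g"
  shows "tensor_map f g (abs_tensor p) = free_extend (\<lambda>k. f (fst k) \<otimes> g (snd k)) p"
proof -
  interpret f: Vector_Spaces.linear scaleQ scaleQ f by fact
  interpret g: Vector_Spaces.linear scaleQ scaleQ g by fact
  have "tensor_rel (rep_tensor (abs_tensor p)) p"
    using Quotient3_rep_abs[OF Quotient3_tensor] equivp_reflp[OF equivp_tensor_rel] by blast
  then have "free_extend (\<lambda>k. f (fst k) \<otimes> g (snd k)) (rep_tensor (abs_tensor p))
      = free_extend (\<lambda>k. f (fst k) \<otimes> g (snd k)) p"
    by (intro free_extend_respects)
       (simp_all add: f.add g.add f.scale g.scale tensor_prod_add_left tensor_prod_add_right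
         tensor_prod_scale_left tensor_prod_scale_right)
  then show ?thesis by (simp add: tensor_map_def free_extend_def)
qed

lemma tensor_map_prod:
  assumes "linearQ f" "linearQ g"
  shows "tensor_map f g (u \<otimes> v) = f u \<otimes> g v"
  by (simp add: tensor_prod.abs_eq tensor_map_abs[OF assms] free_extend_single)

lemma linear_tensor_map:
  fixes f :: "'a::rat_vector \<Rightarrow> 'c::rat_vector" and g :: "'b::rat_vector \<Rightarrow> 'd::rat_vector"
  assumes "linearQ f" "linearQ g"
  shows "linearQ (tensor_map f g)"
proof (rule linearQ_I)
  fix s t :: "('a, 'b) tensor" and c
  obtain p q where st: "s = abs_tensor p" "t = abs_tensor q"
    by (induction s rule: tensor.abs_induct, induction t rule: tensor.abs_induct) blast
  show "tensor_map f g (s + t) = tensor_map f g s + tensor_map f g t"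
    by (simp add: st plus_tensor.abs_eq tensor_map_abs[OF assms] free_extend_add)
  show "tensor_map f g (c *\<^sub>Q s) = c *\<^sub>Q tensor_map f g s"
    by (simp add: st scaleQ_tensor.abs_eq tensor_map_abs[OF assms] free_extend_scale)
qed


section \<open>Compositions\<close>

definition compositions :: "nat list set"
  where "compositions = {\<alpha>. 0 \<notin> set \<alpha>}"

text \<open>\<open>refines \<beta> \<alpha>\<close> is \<open>\<beta> \<preceq> \<alpha>\<close>: summing the consecutive nonempty blocks \<open>bs\<close> of \<open>\<beta>\<close> gives \<open>\<alpha>\<close>.\<close>

definition refines :: "nat list \<Rightarrow> nat list \<Rightarrow> bool"
  where "refines \<beta> \<alpha> \<longleftrightarrow> (\<exists>bs. \<beta> = concat bs \<and> [] \<notin> set bs \<and> \<alpha> = map sum_list bs)"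

definition comp_set :: "nat list \<Rightarrow> nat set"
  where "comp_set \<alpha> = {sum_list (take i \<alpha>) | i. 1 \<le> i \<and> i < length \<alpha>}"

text \<open>For \<open>\<alpha> = []\<close> the right-hand side is \<open>[]\<close>, the only composition of 0.\<close>

definition comp_compl :: "nat list \<Rightarrow> nat list"
  where "comp_compl \<alpha> = (THE \<beta>. \<beta> \<in> compositions \<and> sum_list \<beta> = sum_list \<alpha>
    \<and> comp_set \<beta> = {1..<sum_list \<alpha>} - comp_set \<alpha>)"


section \<open>Quasisymmetric functions\<close>

text \<open>
  A monomial in the variables \<open>x\<^sub>0, x\<^sub>1, \<dots>\<close> is given by its finitely supported exponent function,
  and a formal power series by its coefficients. Indexing the variables from 0 is harmless, as only
  their order matters.
\<close>

type_synonym monomial = "nat \<Rightarrow>\<^sub>0 nat"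

definition mono_deg :: "monomial \<Rightarrow> nat"
  where "mono_deg m = (\<Sum>i \<in> Poly_Mapping.keys m. Poly_Mapping.lookup m i)"

definition mono_of :: "nat list \<Rightarrow> nat list \<Rightarrow> monomial"
  where "mono_of is \<alpha> = (\<Sum>j<length \<alpha>. Poly_Mapping.single (is ! j) (\<alpha> ! j))"

definition index_lists :: "nat \<Rightarrow> nat list set"
  where "index_lists k = {is. length is = k \<and> sorted_wrt (<) is}"

definition quasisymmetric :: "(monomial \<Rightarrow> rat) \<Rightarrow> bool"
  where "quasisymmetric f \<longleftrightarrow>
    (\<exists>d. \<forall>m. f m \<noteq> 0 \<longrightarrow> mono_deg m \<le> d) \<and>
    (\<forall>\<alpha>\<in>compositions. \<forall>is\<in>index_lists (length \<alpha>). \<forall>js\<in>index_lists (length \<alpha>).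
      f (mono_of is \<alpha>) = f (mono_of js \<alpha>))"

lemma quasisymmetric_zero: "quasisymmetric (\<lambda>m. 0)"
  by (simp add: quasisymmetric_def)

lemma quasisymmetric_add:
  assumes "quasisymmetric f" "quasisymmetric g"
  shows "quasisymmetric (\<lambda>m. f m + g m)"
proof -
  obtain d e where "\<And>m. f m \<noteq> 0 \<Longrightarrow> mono_deg m \<le> d" "\<And>m. g m \<noteq> 0 \<Longrightarrow> mono_deg m \<le> e"
    using assms unfolding quasisymmetric_def by metis
  then have "\<forall>m. f m + g m \<noteq> 0 \<longrightarrow> mono_deg m \<le> max d e"
    by (metis add.right_neutral max.coboundedI1 max.coboundedI2)
  moreover have "\<forall>\<alpha>\<in>compositions. \<forall>is\<in>index_lists (length \<alpha>). \<forall>js\<in>index_lists (length \<alpha>).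
      f (mono_of is \<alpha>) + g (mono_of is \<alpha>) = f (mono_of js \<alpha>) + g (mono_of js \<alpha>)"
    using assms unfolding quasisymmetric_def by metis
  ultimately show ?thesis unfolding quasisymmetric_def by blast
qed

lemma quasisymmetric_scale:
  assumes "quasisymmetric f"
  shows "quasisymmetric (\<lambda>m. c * f m)"
proof -
  obtain d where "\<And>m. f m \<noteq> 0 \<Longrightarrow> mono_deg m \<le> d"
    using assms unfolding quasisymmetric_def by metis
  then have "\<forall>m. c * f m \<noteq> 0 \<longrightarrow> mono_deg m \<le> d"
    by auto
  moreover have "\<forall>\<alpha>\<in>compositions. \<forall>is\<in>index_lists (length \<alpha>). \<forall>js\<in>index_lists (length \<alpha>).
      c * f (mono_of is \<alpha>) = c * f (mono_of js \<alpha>)"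
    using assms unfolding quasisymmetric_def by metis
  ultimately show ?thesis unfolding quasisymmetric_def by blast
qed

typedef qsym = "{f. quasisymmetric f}"
  morphisms qcoeff Abs_qsym
  using quasisymmetric_zero by blast

setup_lifting type_definition_qsym

instantiation qsym :: rat_vector
begin

lift_definition zero_qsym :: qsym is "\<lambda>m. 0"
  by (rule quasisymmetric_zero)

lift_definition plus_qsym :: "qsym \<Rightarrow> qsym \<Rightarrow> qsym" is "\<lambda>f g m. f m + g m"
  by (rule quasisymmetric_add)

lift_definition uminus_qsym :: "qsym \<Rightarrow> qsym" is "\<lambda>f m. - f m"
  using quasisymmetric_scale[of _ "-1"] by simp

definition minus_qsym :: "qsym \<Rightarrow> qsym \<Rightarrow> qsym"
  where "minus_qsym f g = f + (- g)"

lift_definition scaleQ_qsym :: "rat \<Rightarrow> qsym \<Rightarrow> qsym" is "\<lambda>c f m. c * f m"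
  by (rule quasisymmetric_scale)

instance
proof
  fix a b c :: qsym and x y :: rat
  show "a + b + c = a + (b + c)" by transfer (simp add: add.assoc)
  show "a + b = b + a" by transfer (simp add: add.commute)
  show "0 + a = a" by transfer simp
  show "- a + a = 0" by transfer simp
  show "a - b = a + - b" by (rule minus_qsym_def)
  show "x *\<^sub>Q (a + b) = x *\<^sub>Q a + x *\<^sub>Q b" by transfer (simp add: distrib_left)
  show "(x + y) *\<^sub>Q a = x *\<^sub>Q a + y *\<^sub>Q a" by transfer (simp add: distrib_right)
  show "x *\<^sub>Q y *\<^sub>Q a = (x * y) *\<^sub>Q a" by transfer (simp add: mult.assoc)
  show "1 *\<^sub>Q a = a" by transfer simp
qed

end

text \<open>
  Only meaningful for \<open>\<alpha> \<in> compositions\<close>. The monomials of the defining series are pairwise distinct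
  (\<open>mono_of_inject\<close>), so its coefficients are 0 and 1.
\<close>

definition monomial_qsym :: "nat list \<Rightarrow> qsym"
  where "monomial_qsym \<alpha> =
    Abs_qsym (\<lambda>m. if \<exists>is\<in>index_lists (length \<alpha>). m = mono_of is \<alpha> then 1 else 0)"

definition fundamental_qsym :: "nat list \<Rightarrow> qsym"
  where "fundamental_qsym \<alpha> = (\<Sum>\<beta> | \<beta> \<in> compositions \<and> refines \<beta> \<alpha>. monomial_qsym \<beta>)"

definition fundamental_basis :: "qsym set"
  where "fundamental_basis = fundamental_qsym ` compositions"

definition qsym_degree :: "nat \<Rightarrow> qsym set"
  where "qsym_degree n =
    ratvec.span (fundamental_qsym ` {\<alpha> \<in> compositions. sum_list \<alpha> = n})"

text \<open>The coefficient of \<open>M\<^sub>\<alpha>\<close> in \<open>f\<close>, read off from one monomial with exponents \<open>\<alpha>\<close>.\<close>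

definition mcoeff :: "qsym \<Rightarrow> nat list \<Rightarrow> rat"
  where "mcoeff f \<alpha> = qcoeff f (mono_of [0..<length \<alpha>] \<alpha>)"

definition counit :: "qsym \<Rightarrow> rat"
  where "counit f = mcoeff f []"

text \<open>
  The linear extension of \<open>\<Delta>(M\<^sub>\<alpha>) = \<Sum> M\<^sub>\<beta> \<otimes> M\<^sub>\<gamma>\<close> along \<open>f = \<Sum> (mcoeff f \<alpha>) M\<^sub>\<alpha>\<close>, a finite sum because
  \<open>f\<close> has bounded degree; see \<open>comult_monomial\<close> and \<open>linear_comult\<close> below.
\<close>

definition comult :: "qsym \<Rightarrow> (qsym, qsym) tensor"
  where "comult f = (\<Sum>\<alpha> | \<alpha> \<in> compositions \<and> mcoeff f \<alpha> \<noteq> 0.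
    mcoeff f \<alpha> *\<^sub>Q (\<Sum>(\<beta>, \<gamma>) \<in> {(\<beta>, \<gamma>). \<beta> @ \<gamma> = \<alpha>}. monomial_qsym \<beta> \<otimes> monomial_qsym \<gamma>))"

definition coalgebra_hom :: "(qsym \<Rightarrow> qsym) \<Rightarrow> bool"
  where "coalgebra_hom \<phi> \<longleftrightarrow> linearQ \<phi>
    \<and> (\<forall>f. comult (\<phi> f) = tensor_map \<phi> \<phi> (comult f))
    \<and> (\<forall>f. counit (\<phi> f) = counit f)"

definition graded :: "(qsym \<Rightarrow> qsym) \<Rightarrow> bool"
  where "graded \<phi> \<longleftrightarrow> (\<forall>n. \<phi> ` qsym_degree n \<subseteq> qsym_degree n)"

definition graded_coalgebra_aut :: "(qsym \<Rightarrow> qsym) \<Rightarrow> bool"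
  where "graded_coalgebra_aut \<phi> \<longleftrightarrow> bij \<phi>
    \<and> coalgebra_hom \<phi> \<and> graded \<phi> \<and> coalgebra_hom (inv \<phi>) \<and> graded (inv \<phi>)"


subsection \<open>Consistency of the definitions\<close>

lemma lookup_mono_of_nth:
  assumes "is \<in> index_lists (length \<alpha>)" "j < length \<alpha>"
  shows "Poly_Mapping.lookup (mono_of is \<alpha>) (is ! j) = \<alpha> ! j"
proof -
  have d: "distinct is" "length is = length \<alpha>"
    using assms by (auto simp: index_lists_def strict_sorted_iff)
  have "Poly_Mapping.lookup (mono_of is \<alpha>) (is ! j) = (\<Sum>i<length \<alpha>. if i = j then \<alpha> ! i else 0)"
    unfolding mono_of_def lookup_sum
    by (rule sum.cong) (use d assms(2) in \<open>auto simp: lookup_single when_def nth_eq_iff_index_eq\<close>)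
  then show ?thesis using assms(2) by simp
qed

lemma lookup_mono_of_notin:
  assumes "length is = length \<alpha>" "i \<notin> set is"
  shows "Poly_Mapping.lookup (mono_of is \<alpha>) i = 0"
  using assms by (auto simp: mono_of_def lookup_sum lookup_single when_def)

lemma keys_mono_of:
  assumes "is \<in> index_lists (length \<alpha>)" "\<alpha> \<in> compositions"
  shows "Poly_Mapping.keys (mono_of is \<alpha>) = set is"
proof -
  have len: "length is = length \<alpha>" using assms by (simp add: index_lists_def)
  have "Poly_Mapping.lookup (mono_of is \<alpha>) i \<noteq> 0" if "i \<in> set is" for i
    using that lookup_mono_of_nth[OF assms(1)] assms(2) len
    by (metis compositions_def in_set_conv_nth mem_Collect_eq)
  then show ?thesis
    using lookup_mono_of_notin[OF len] by (auto simp: in_keys_iff)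
qed

lemma mono_of_inject:
  assumes "\<alpha> \<in> compositions" "is \<in> index_lists (length \<alpha>)"
    and "\<beta> \<in> compositions" "js \<in> index_lists (length \<beta>)"
    and "mono_of is \<alpha> = mono_of js \<beta>"
  shows "is = js \<and> \<alpha> = \<beta>"
proof -
  have "set is = set js" using keys_mono_of assms by metis
  then have ij: "is = js"
    using assms(2,4) by (auto simp: index_lists_def intro: strict_sorted_equal)
  then have len: "length \<alpha> = length \<beta>" using assms(2,4) by (simp add: index_lists_def)
  moreover have "\<alpha> ! j = \<beta> ! j" if "j < length \<alpha>" for j
    using lookup_mono_of_nth[OF assms(2) that] lookup_mono_of_nth[OF assms(4), of j]
      that len ij assms(5) by simp
  ultimately show ?thesis using ij by (auto intro: nth_equalityI)
qed

lemma mono_deg_mono_of: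
  assumes "is \<in> index_lists (length \<alpha>)" "\<alpha> \<in> compositions"
  shows "mono_deg (mono_of is \<alpha>) = sum_list \<alpha>"
proof -
  have d: "distinct is" "length is = length \<alpha>"
    using assms by (auto simp: index_lists_def strict_sorted_iff)
  have "mono_deg (mono_of is \<alpha>) = sum_list (map (Poly_Mapping.lookup (mono_of is \<alpha>)) is)"
    by (simp add: mono_deg_def keys_mono_of[OF assms] sum_list_distinct_conv_sum_set[OF d(1)])
  also have "map (Poly_Mapping.lookup (mono_of is \<alpha>)) is = \<alpha>"
    by (rule nth_equalityI) (simp_all add: d lookup_mono_of_nth[OF assms(1)])
  finally show ?thesis .
qed

lemma upt_index_list: "[0..<k] \<in> index_lists k"
  by (simp add: index_lists_def)

lemma qcoeff_monomial:
  assumes "\<alpha> \<in> compositions"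
  shows "qcoeff (monomial_qsym \<alpha>) m =
    (if \<exists>is\<in>index_lists (length \<alpha>). m = mono_of is \<alpha> then 1 else 0)"
proof -
  let ?f = "\<lambda>m. (if \<exists>is\<in>index_lists (length \<alpha>). m = mono_of is \<alpha> then 1 else 0) :: rat"
  have bounded: "\<forall>m. ?f m \<noteq> 0 \<longrightarrow> mono_deg m \<le> sum_list \<alpha>"
    using mono_deg_mono_of[OF _ assms] by auto
  have coeffs: "?f (mono_of is \<beta>) = (if \<beta> = \<alpha> then 1 else 0)"
    if "\<beta> \<in> compositions" "is \<in> index_lists (length \<beta>)" for \<beta> "is"
    using mono_of_inject[OF that assms] that(2) by auto
  have "?f (mono_of is \<beta>) = ?f (mono_of js \<beta>)"
    if "\<beta> \<in> compositions" "is \<in> index_lists (length \<beta>)" "js \<in> index_lists (length \<beta>)"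
    for \<beta> "is" js
    by (simp only: coeffs[OF that(1,2)] coeffs[OF that(1,3)])
  then have "quasisymmetric ?f"
    unfolding quasisymmetric_def using bounded by (intro conjI exI[of _ "sum_list \<alpha>"] ballI) blast+
  then show ?thesis by (simp add: monomial_qsym_def Abs_qsym_inverse)
qed

lemma mcoeff_monomial:
  assumes "\<alpha> \<in> compositions" "\<beta> \<in> compositions"
  shows "mcoeff (monomial_qsym \<alpha>) \<beta> = (if \<beta> = \<alpha> then 1 else 0)"
  using mono_of_inject[OF assms(2) upt_index_list] assms upt_index_list
  by (auto simp: mcoeff_def qcoeff_monomial)

lemma finite_compositions: "finite {\<alpha> \<in> compositions. sum_list \<alpha> \<le> n}"
proof (rule finite_subset)
  have "length \<alpha> \<le> sum_list \<alpha> \<and> (\<forall>x\<in>set \<alpha>. x \<le> sum_list \<alpha>)" if "0 \<notin> set \<alpha>" for \<alpha> :: "nat list"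
    using that by (induction \<alpha>) auto
  then show "{\<alpha> \<in> compositions. sum_list \<alpha> \<le> n} \<subseteq> {xs. set xs \<subseteq> {..n} \<and> length xs \<le> n}"
    by (fastforce simp: compositions_def)
  show "finite {xs. set xs \<subseteq> {..n} \<and> length xs \<le> n}"
    by (rule finite_lists_length_le) simp
qed

lemma finite_mcoeff: "finite {\<alpha>. \<alpha> \<in> compositions \<and> mcoeff f \<alpha> \<noteq> 0}"
proof -
  obtain d where d: "\<And>m. qcoeff f m \<noteq> 0 \<Longrightarrow> mono_deg m \<le> d"
    using qcoeff[of f] by (auto simp: quasisymmetric_def)
  have "{\<alpha>. \<alpha> \<in> compositions \<and> mcoeff f \<alpha> \<noteq> 0} \<subseteq> {\<alpha> \<in> compositions. sum_list \<alpha> \<le> d}"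
    using d mono_deg_mono_of[OF upt_index_list] by (fastforce simp: mcoeff_def)
  then show ?thesis using finite_compositions finite_subset by blast
qed

lemma comult_monomial:
  assumes "\<alpha> \<in> compositions"
  shows "comult (monomial_qsym \<alpha>) =
    (\<Sum>(\<beta>, \<gamma>) \<in> {(\<beta>, \<gamma>). \<beta> @ \<gamma> = \<alpha>}. monomial_qsym \<beta> \<otimes> monomial_qsym \<gamma>)"
proof -
  have "{\<alpha>'. \<alpha>' \<in> compositions \<and> mcoeff (monomial_qsym \<alpha>) \<alpha>' \<noteq> 0} = {\<alpha>}"
    using mcoeff_monomial[OF assms] assms by (auto split: if_splits)
  then show ?thesis by (simp add: comult_def mcoeff_monomial[OF assms assms])
qed

lemma linear_comult: "linearQ comult"
proof (rule linearQ_I)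
  let ?S = "\<lambda>f. {\<alpha>. \<alpha> \<in> compositions \<and> mcoeff f \<alpha> \<noteq> 0}"
  let ?D = "\<lambda>\<alpha>. (\<Sum>(\<beta>, \<gamma>) \<in> {(\<beta>, \<gamma>). \<beta> @ \<gamma> = \<alpha>}. monomial_qsym \<beta> \<otimes> monomial_qsym \<gamma>)"
  have sup: "comult f = (\<Sum>\<alpha>\<in>A. mcoeff f \<alpha> *\<^sub>Q ?D \<alpha>)"
    if "finite A" "?S f \<subseteq> A" "A \<subseteq> compositions" for f A
    unfolding comult_def by (rule sum.mono_neutral_left) (use that in auto)
  fix f g :: qsym and c
  have add: "mcoeff (f + g) \<alpha> = mcoeff f \<alpha> + mcoeff g \<alpha>" for \<alpha>
    by (simp add: mcoeff_def plus_qsym.rep_eq)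
  have scale: "mcoeff (c *\<^sub>Q f) \<alpha> = c * mcoeff f \<alpha>" for \<alpha>
    by (simp add: mcoeff_def scaleQ_qsym.rep_eq)
  let ?A = "?S f \<union> ?S g"
  have A: "finite ?A" "?A \<subseteq> compositions" using finite_mcoeff by auto
  have "comult (f + g) = (\<Sum>\<alpha>\<in>?A. mcoeff (f + g) \<alpha> *\<^sub>Q ?D \<alpha>)"
    by (rule sup) (use A in \<open>auto simp: add\<close>)
  also have "\<dots> = comult f + comult g"
    using sup[of ?A f] sup[of ?A g] A
    by (simp add: add ratvec.scale_left_distrib sum.distrib)
  finally show "comult (f + g) = comult f + comult g" .
  have "comult (c *\<^sub>Q f) = (\<Sum>\<alpha>\<in>?A. mcoeff (c *\<^sub>Q f) \<alpha> *\<^sub>Q ?D \<alpha>)"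
    by (rule sup) (use A in \<open>auto simp: scale\<close>)
  also have "\<dots> = c *\<^sub>Q comult f"
    using sup[of ?A f] A by (simp add: scale ratvec.scale_sum_right)
  finally show "comult (c *\<^sub>Q f) = c *\<^sub>Q comult f" .
qed

end

theory Submission
  imports Defs
begin

text \<open>
  A composition \<open>\<alpha>\<close> of \<open>n\<close> is a way of cutting a row of \<open>n\<close> boxes into pieces, and it is recorded by
  the set \<open>psums \<alpha>\<close> of its cut positions, with both ends \<open>0\<close> and \<open>n\<close> included. In this language
  refining means adding cuts, and complementation toggles every inner position. The
  coproduct of a fundamental function breaks the row at each of the \<open>n + 1\<close> positions in turn,
  whether or not there is a cut there (concatenation or near concatenation):
  \<open>\<Delta>(F\<^sub>\<alpha>) = \<Sum>i\<le>n. F(comp_take i \<alpha>) \<otimes> F(comp_drop i \<alpha>)\<close>, see \<open>comult_fundamental\<close>. Restricting a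
  cut set to either side of a position commutes with toggling, so complementation respects this
  formula; being an involution that preserves size, it is a graded coalgebra automorphism.

  For uniqueness, let a graded coalgebra automorphism permute the fundamental basis by
  \<open>F\<^sub>\<alpha> \<mapsto> F(\<sigma> \<alpha>)\<close>. Because the \<open>i\<close>-th term of the coproduct is the only one with left
  factor of degree \<open>i\<close>, comparing coefficients shows that \<open>\<sigma>\<close> commutes with \<open>comp_take i\<close> and
  \<open>comp_drop i\<close> (\<open>\<sigma>_cut\<close>). Whether \<open>j\<close> is a cut of \<open>\<sigma> \<alpha>\<close> can be read off from the two boxes
  surrounding position \<open>j\<close>; hence it depends only on whether \<open>j\<close> is a cut of \<open>\<alpha>\<close> and on the action
  of \<open>\<sigma>\<close> on the two compositions \<open>(2)\<close> and \<open>(1, 1)\<close> of 2. If \<open>\<sigma>\<close> fixes these two it is the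
  identity, and if it exchanges them it is complementation (\<open>\<sigma>_cases\<close>).

  Comparing coefficients requires functionals dual to the fundamental basis. They arise by
  inverting the unitriangular relation between coefficients of monomial and of fundamental
  functions (\<open>dual_functional_exists\<close>), and products of two of them separate the tensors
  \<open>F\<^sub>\<beta> \<otimes> F\<^sub>\<gamma>\<close>.
\<close>

section \<open>Compositions as sets of partial sums\<close>

text \<open>
  Keeping both end points in the set makes it determine the size of the composition as its maximum,
  so that compositions of all sizes together correspond to the finite sets containing \<open>0\<close>.
\<close>

definition psums :: "nat list \<Rightarrow> nat set"
  where "psums \<alpha> = (\<lambda>i. sum_list (take i \<alpha>)) ` {..length \<alpha>}"

lemma psums_Nil [simp]: "psums [] = {0}"
  by (simp add: psums_def)

lemma psums_Cons [simp]: "psums (a # \<alpha>) = insert 0 ((+) a ` psums \<alpha>)"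
  by (simp add: psums_def atMost_Suc_eq_insert_0 image_image)

lemma zero_in_psums [simp]: "0 \<in> psums \<alpha>"
  by (cases \<alpha>) auto

lemma finite_psums [simp]: "finite (psums \<alpha>)"
  by (simp add: psums_def)

lemma sum_list_in_psums [simp]: "sum_list \<alpha> \<in> psums \<alpha>"
  by (induction \<alpha>) auto

lemma psums_le: "x \<in> psums \<alpha> \<Longrightarrow> x \<le> sum_list \<alpha>"
  by (induction \<alpha> arbitrary: x) auto

lemma psums_append: "psums (\<beta> @ \<gamma>) = psums \<beta> \<union> (+) (sum_list \<beta>) ` psums \<gamma>"
  by (induction \<beta>) (auto simp: image_Un image_image add.assoc)

lemma psums_split:
  assumes "x \<in> psums \<alpha>"
  obtains \<beta> \<gamma> where "\<alpha> = \<beta> @ \<gamma>" "sum_list \<beta> = x"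
proof -
  from assms obtain i where "x = sum_list (take i \<alpha>)" by (auto simp: psums_def)
  then show thesis using that[of "take i \<alpha>" "drop i \<alpha>"] by simp
qed

lemma sum_list_eq_if_psums_eq: "psums \<alpha> = psums \<beta> \<Longrightarrow> sum_list \<alpha> = sum_list \<beta>"
  using psums_le[of "sum_list \<alpha>" \<beta>] psums_le[of "sum_list \<beta>" \<alpha>]
    sum_list_in_psums[of \<alpha>] sum_list_in_psums[of \<beta>] by simp

text \<open>
  The first part is the least positive partial sum; the tails then have equal partial sums too.
\<close>

lemma psums_inject:
  assumes "\<alpha> \<in> compositions" "\<beta> \<in> compositions" "psums \<alpha> = psums \<beta>"
  shows "\<alpha> = \<beta>"
  using assms
proof (induction \<alpha> arbitrary: \<beta>)
  case Nil
  then have "sum_list \<beta> = 0" using sum_list_eq_if_psums_eq[of "[]" \<beta>] by simp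
  then show ?case using Nil.prems(2) by (cases \<beta>) (simp_all add: compositions_def)
next
  case (Cons a \<alpha>)
  from Cons.prems have "a > 0" by (simp add: compositions_def)
  moreover have "sum_list \<beta> = a + sum_list \<alpha>"
    using sum_list_eq_if_psums_eq[OF Cons.prems(3)] by simp
  ultimately obtain b \<beta>' where \<beta>: "\<beta> = b # \<beta>'" by (cases \<beta>) simp_all
  from Cons.prems \<beta> have "b > 0" by (simp add: compositions_def)
  have "a \<in> psums \<beta>"
    unfolding Cons.prems(3)[symmetric] by (simp add: image_iff)
  then have "b \<le> a" using \<beta> \<open>a > 0\<close> by auto
  have "b \<in> psums (a # \<alpha>)"
    unfolding Cons.prems(3) \<beta> by (simp add: image_iff)
  then have "a \<le> b" using \<open>b > 0\<close> by auto
  with \<open>b \<le> a\<close> have ab: "b = a" by simp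
  have "0 \<notin> (+) a ` psums \<alpha>" "0 \<notin> (+) a ` psums \<beta>'" using \<open>a > 0\<close> by auto
  then have "(+) a ` psums \<alpha> = (+) a ` psums \<beta>'"
    using Cons.prems(3) \<beta> ab by (simp add: insert_ident)
  then have "psums \<alpha> = psums \<beta>'" by (simp add: inj_image_eq_iff)
  then show ?case using Cons \<beta> ab by (simp add: compositions_def)
qed

lemma psums_surj:
  assumes "finite A" "0 \<in> A"
  shows "\<exists>\<alpha>\<in>compositions. psums \<alpha> = A"
  using assms
proof (induction A rule: finite_linorder_max_induct)
  case empty
  then show ?case by simp
next
  case (insert m A)
  show ?case
  proof (cases "0 \<in> A")
    case True
    then obtain \<alpha> where \<alpha>: "\<alpha> \<in> compositions" "psums \<alpha> = A" using insert.IH by blast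
    then have "sum_list \<alpha> \<in> A" using sum_list_in_psums by blast
    then have less: "sum_list \<alpha> < m" using insert.hyps by blast
    have "psums (\<alpha> @ [m - sum_list \<alpha>]) = insert m A"
      using less \<alpha>(2) \<open>sum_list \<alpha> \<in> A\<close> by (auto simp: psums_append)
    moreover have "\<alpha> @ [m - sum_list \<alpha>] \<in> compositions"
      using \<alpha>(1) less by (simp add: compositions_def)
    ultimately show ?thesis by blast
  next
    case False
    then have "m = 0" using insert.prems by simp
    then have "insert m A = {0}" using insert.hyps by auto
    then have "psums [] = insert m A" by simp
    then show ?thesis by (intro bexI[of _ "[]"]) (simp_all add: compositions_def)
  qed
qed

definition comp_of :: "nat set \<Rightarrow> nat list"
  where "comp_of A = (THE \<alpha>. \<alpha> \<in> compositions \<and> psums \<alpha> = A)"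

lemma comp_of:
  assumes "finite A" "0 \<in> A"
  shows "comp_of A \<in> compositions" "psums (comp_of A) = A"
proof -
  have "\<exists>!\<alpha>. \<alpha> \<in> compositions \<and> psums \<alpha> = A"
    using psums_surj[OF assms] psums_inject by blast
  from theI'[OF this] show "comp_of A \<in> compositions" "psums (comp_of A) = A"
    by (simp_all add: comp_of_def)
qed

lemma sum_list_eq_if_greatest:
  assumes "x \<in> psums \<alpha>" "\<And>y. y \<in> psums \<alpha> \<Longrightarrow> y \<le> x"
  shows "sum_list \<alpha> = x"
  by (rule le_antisym) (simp_all add: assms psums_le)

lemma comp_set_eq_psums:
  assumes "\<alpha> \<in> compositions"
  shows "comp_set \<alpha> = psums \<alpha> - {0, sum_list \<alpha>}"
proof -
  have inner: "sum_list (take i \<alpha>) \<noteq> 0 \<and> sum_list (take i \<alpha>) \<noteq> sum_list \<alpha>"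
    if "1 \<le> i" "i < length \<alpha>" for i
  proof -
    have pos: "sum_list xs \<noteq> 0" if "set xs \<subseteq> set \<alpha>" "xs \<noteq> []" for xs
      using that assms by (cases xs) (auto simp: compositions_def)
    have "sum_list \<alpha> = sum_list (take i \<alpha>) + sum_list (drop i \<alpha>)"
      by (metis append_take_drop_id sum_list_append)
    moreover have "sum_list (drop i \<alpha>) \<noteq> 0"
      by (rule pos) (use that in \<open>auto dest: in_set_dropD\<close>)
    moreover have "sum_list (take i \<alpha>) \<noteq> 0"
      by (rule pos) (use that in \<open>auto dest: in_set_takeD\<close>)
    ultimately show ?thesis by simp
  qed
  show ?thesis
  proof (intro equalityI subsetI)
    fix x assume "x \<in> comp_set \<alpha>"
    then show "x \<in> psums \<alpha> - {0, sum_list \<alpha>}"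
      unfolding comp_set_def psums_def using inner by fastforce
  next
    fix x assume x: "x \<in> psums \<alpha> - {0, sum_list \<alpha>}"
    then obtain i where i: "i \<le> length \<alpha>" "x = sum_list (take i \<alpha>)" by (auto simp: psums_def)
    then have "i \<noteq> 0" "i \<noteq> length \<alpha>" using x
      by (metis Diff_iff insertCI sum_list.Nil take0, metis Diff_iff insertCI take_all_iff order_refl)
    then show "x \<in> comp_set \<alpha>" using i unfolding comp_set_def by force
  qed
qed

lemma psums_eq_comp_set:
  assumes "\<alpha> \<in> compositions"
  shows "psums \<alpha> = {0, sum_list \<alpha>} \<union> comp_set \<alpha>"
  unfolding comp_set_eq_psums[OF assms] using zero_in_psums sum_list_in_psums by blast

text \<open>
  For the converse direction the first part \<open>a\<close> of \<open>\<alpha>\<close> is a partial sum of \<open>\<beta>\<close>, so an initial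
  segment of \<open>\<beta>\<close> sums to \<open>a\<close>. It becomes the first block, and induction splits the rest.
\<close>

lemma refines_iff_psums:
  assumes "\<alpha> \<in> compositions" "\<beta> \<in> compositions"
  shows "refines \<beta> \<alpha> \<longleftrightarrow> sum_list \<beta> = sum_list \<alpha> \<and> psums \<alpha> \<subseteq> psums \<beta>"
proof
  have "psums (map sum_list bs) \<subseteq> psums (concat bs)
      \<and> sum_list (concat bs) = sum_list (map sum_list bs)" for bs :: "nat list list"
    by (induction bs) (auto simp: psums_append)
  then show "sum_list \<beta> = sum_list \<alpha> \<and> psums \<alpha> \<subseteq> psums \<beta>" if "refines \<beta> \<alpha>"
    using that unfolding refines_def by auto
next
  assume "sum_list \<beta> = sum_list \<alpha> \<and> psums \<alpha> \<subseteq> psums \<beta>"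
  then show "refines \<beta> \<alpha>"
    using assms
  proof (induction \<alpha> arbitrary: \<beta>)
    case Nil
    then have "\<beta> = []" by (cases \<beta>) (auto simp: compositions_def)
    then show ?case by (simp add: refines_def)
  next
    case (Cons a \<alpha>)
    from Cons.prems have "a > 0" by (simp add: compositions_def)
    have "a \<in> psums (a # \<alpha>)" by (simp add: image_iff)
    then obtain \<gamma> \<delta> where \<beta>: "\<beta> = \<gamma> @ \<delta>" "sum_list \<gamma> = a"
      using Cons.prems(1) psums_split by blast
    have "psums \<alpha> \<subseteq> psums \<delta>"
    proof
      fix x assume "x \<in> psums \<alpha>"
      then have "a + x \<in> psums \<gamma> \<union> (+) a ` psums \<delta>"
        using Cons.prems(1) \<beta> by (auto simp: psums_append)
      then show "x \<in> psums \<delta>" using psums_le[of "a + x" \<gamma>] \<beta> by auto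
    qed
    then have "refines \<delta> \<alpha>"
      using Cons.prems \<beta> by (intro Cons.IH) (auto simp: compositions_def)
    then obtain bs where "\<delta> = concat bs" "[] \<notin> set bs" "\<alpha> = map sum_list bs"
      unfolding refines_def by blast
    then show ?case
      unfolding refines_def using \<beta> \<open>a > 0\<close> by (intro exI[of _ "\<gamma> # bs"]) auto
  qed
qed


section \<open>Cutting and complementing compositions\<close>

text \<open>
  For \<open>i \<le> n = sum_list \<alpha>\<close>, \<open>comp_take i \<alpha>\<close> and \<open>comp_drop i \<alpha>\<close> are the compositions of \<open>i\<close> and of
  \<open>n - i\<close> obtained by breaking \<open>\<alpha>\<close> at position \<open>i\<close>. If \<open>i\<close> is a partial sum of \<open>\<alpha>\<close>, then \<open>\<alpha>\<close> is the
  concatenation of the two; otherwise, a part of \<open>\<alpha>\<close> is broken and \<open>\<alpha>\<close> is their near concatenation.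
\<close>

definition comp_take :: "nat \<Rightarrow> nat list \<Rightarrow> nat list"
  where "comp_take i \<alpha> = comp_of (insert i (psums \<alpha> \<inter> {..i}))"

definition comp_drop :: "nat \<Rightarrow> nat list \<Rightarrow> nat list"
  where "comp_drop i \<alpha> = comp_of (insert 0 ((\<lambda>x. x - i) ` (psums \<alpha> \<inter> {i..})))"

lemma comp_take:
  shows comp_take_in: "comp_take i \<alpha> \<in> compositions"
    and psums_comp_take: "psums (comp_take i \<alpha>) = insert i (psums \<alpha> \<inter> {..i})"
    and sum_list_comp_take: "sum_list (comp_take i \<alpha>) = i"
proof -
  show "comp_take i \<alpha> \<in> compositions"
    and p: "psums (comp_take i \<alpha>) = insert i (psums \<alpha> \<inter> {..i})"
    using comp_of[of "insert i (psums \<alpha> \<inter> {..i})"] by (simp_all add: comp_take_def)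
  show "sum_list (comp_take i \<alpha>) = i"
    by (rule sum_list_eq_if_greatest) (auto simp: p)
qed

lemma comp_drop:
  shows comp_drop_in: "comp_drop i \<alpha> \<in> compositions"
    and psums_comp_drop:
      "psums (comp_drop i \<alpha>) = insert 0 ((\<lambda>x. x - i) ` (psums \<alpha> \<inter> {i..}))"
    and sum_list_comp_drop: "sum_list (comp_drop i \<alpha>) = sum_list \<alpha> - i"
proof -
  show "comp_drop i \<alpha> \<in> compositions"
    and p: "psums (comp_drop i \<alpha>) = insert 0 ((\<lambda>x. x - i) ` (psums \<alpha> \<inter> {i..}))"
    using comp_of[of "insert 0 ((\<lambda>x. x - i) ` (psums \<alpha> \<inter> {i..}))"]
    by (simp_all add: comp_drop_def)
  show "sum_list (comp_drop i \<alpha>) = sum_list \<alpha> - i"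
  proof (rule sum_list_eq_if_greatest)
    show "sum_list \<alpha> - i \<in> psums (comp_drop i \<alpha>)"
      by (cases "i \<le> sum_list \<alpha>") (simp_all add: p)
    show "y \<le> sum_list \<alpha> - i" if "y \<in> psums (comp_drop i \<alpha>)" for y
      using that psums_le[of _ \<alpha>] by (auto simp: p diff_le_mono)
  qed
qed

lemma comp_compl:
  assumes "\<alpha> \<in> compositions"
  shows comp_compl_in: "comp_compl \<alpha> \<in> compositions"
    and sum_list_comp_compl: "sum_list (comp_compl \<alpha>) = sum_list \<alpha>"
    and psums_comp_compl:
      "psums (comp_compl \<alpha>) = {0, sum_list \<alpha>} \<union> ({..sum_list \<alpha>} - psums \<alpha>)"
proof -
  let ?n = "sum_list \<alpha>"
  define A where "A = {0, ?n} \<union> ({..?n} - psums \<alpha>)"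
  have "finite A" "0 \<in> A" by (simp_all add: A_def)
  note \<beta> = comp_of[OF this]
  have n: "sum_list (comp_of A) = ?n"
    by (rule sum_list_eq_if_greatest; unfold \<beta>(2)) (auto simp: A_def)
  have minus: "{1..<?n} - comp_set \<alpha> = A - {0, ?n}"
  proof (rule set_eqI)
    show "x \<in> {1..<?n} - comp_set \<alpha> \<longleftrightarrow> x \<in> A - {0, ?n}" for x
      by (cases "x = 0"; cases "x = ?n") (auto simp: comp_set_eq_psums[OF assms] A_def)
  qed
  have "comp_compl \<alpha> = comp_of A"
    unfolding comp_compl_def
  proof (rule the_equality)
    show "comp_of A \<in> compositions \<and> sum_list (comp_of A) = ?n
        \<and> comp_set (comp_of A) = {1..<?n} - comp_set \<alpha>"
      unfolding minus using \<beta> n by (simp add: comp_set_eq_psums)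
  next
    fix \<gamma>
    assume \<gamma>: "\<gamma> \<in> compositions \<and> sum_list \<gamma> = ?n \<and> comp_set \<gamma> = {1..<?n} - comp_set \<alpha>"
    then have "psums \<gamma> = {0, ?n} \<union> (A - {0, ?n})"
      unfolding minus[symmetric] using psums_eq_comp_set[of \<gamma>] by simp
    also have "\<dots> = A" by (auto simp: A_def)
    finally show "\<gamma> = comp_of A" using \<beta> \<gamma> psums_inject by metis
  qed
  with \<beta> n A_def show "comp_compl \<alpha> \<in> compositions" "sum_list (comp_compl \<alpha>) = ?n"
    "psums (comp_compl \<alpha>) = {0, ?n} \<union> ({..?n} - psums \<alpha>)"
    by simp_all
qed

lemma comp_compl_comp_compl:
  assumes "\<alpha> \<in> compositions"
  shows "comp_compl (comp_compl \<alpha>) = \<alpha>"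
proof (rule psums_inject)
  show "psums (comp_compl (comp_compl \<alpha>)) = psums \<alpha>"
    using assms psums_le[of _ \<alpha>] by (auto simp: comp_compl)
qed (simp_all add: assms comp_compl)

lemma comp_compl_Nil: "comp_compl [] = []"
proof -
  have "[] \<in> compositions" by (simp add: compositions_def)
  then show ?thesis by (intro psums_inject) (simp_all add: comp_compl)
qed

text \<open>
  Toggling all inner cuts on one side of position \<open>i\<close> can be done before or after breaking the row
  at \<open>i\<close>; position \<open>i\<close> itself becomes an end point either way.
\<close>

lemma comp_take_comp_compl:
  assumes "\<alpha> \<in> compositions" "i \<le> sum_list \<alpha>"
  shows "comp_take i (comp_compl \<alpha>) = comp_compl (comp_take i \<alpha>)"
proof (rule psums_inject)
  show "psums (comp_take i (comp_compl \<alpha>)) = psums (comp_compl (comp_take i \<alpha>))"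
    using assms by (auto simp: comp_take comp_compl)
qed (simp_all add: assms comp_take comp_compl)

lemma in_psums_comp_drop: "x \<in> psums (comp_drop i \<alpha>) \<longleftrightarrow> x = 0 \<or> x + i \<in> psums \<alpha>"
  by (force simp: psums_comp_drop image_iff)

lemma comp_drop_comp_compl:
  assumes "\<alpha> \<in> compositions" "i \<le> sum_list \<alpha>"
  shows "comp_drop i (comp_compl \<alpha>) = comp_compl (comp_drop i \<alpha>)"
proof (rule psums_inject)
  show "psums (comp_drop i (comp_compl \<alpha>)) = psums (comp_compl (comp_drop i \<alpha>))"
  proof (rule set_eqI)
    show "x \<in> psums (comp_drop i (comp_compl \<alpha>)) \<longleftrightarrow> x \<in> psums (comp_compl (comp_drop i \<alpha>))" for x
      using assms by (auto simp: in_psums_comp_drop comp_drop_in sum_list_comp_drop comp_compl)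
  qed
qed (simp_all add: assms comp_drop comp_compl)

text \<open>
  This equivalence turns \<open>\<Delta>(M\<^sub>\<delta>)\<close>, summed over the refinements \<open>\<delta>\<close> of \<open>\<alpha>\<close>, into the coproduct of
  \<open>F\<^sub>\<alpha>\<close>: a deconcatenation \<open>\<delta> = \<beta> @ \<gamma>\<close> amounts to a position \<open>i = sum_list \<beta>\<close> and independent
  refinements of the two pieces of \<open>\<alpha>\<close>. When \<open>i\<close> is not a cut of \<open>\<alpha>\<close>, it is still one of \<open>\<delta>\<close>.
\<close>

lemma refines_append_iff:
  assumes "\<alpha> \<in> compositions" "\<beta> \<in> compositions" "\<gamma> \<in> compositions" "sum_list \<beta> \<le> sum_list \<alpha>"
  shows "refines (\<beta> @ \<gamma>) \<alpha> \<longleftrightarrow>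
    refines \<beta> (comp_take (sum_list \<beta>) \<alpha>) \<and> refines \<gamma> (comp_drop (sum_list \<beta>) \<alpha>)"
proof -
  let ?i = "sum_list \<beta>"
  have "x \<in> psums \<beta> \<union> (+) ?i ` psums \<gamma> \<longleftrightarrow>
      (x \<le> ?i \<longrightarrow> x \<in> psums \<beta>) \<and> (?i \<le> x \<longrightarrow> x - ?i \<in> psums \<gamma>)" for x
  proof (cases x ?i rule: linorder_cases)
    case less
    then show ?thesis by auto
  next
    case equal
    then show ?thesis by simp
  next
    case greater
    then obtain y where "x = ?i + y" using less_imp_add_positive by blast
    then show ?thesis using greater psums_le[of x \<beta>] by auto
  qed
  then have "psums \<alpha> \<subseteq> psums (\<beta> @ \<gamma>) \<longleftrightarrow>
      psums (comp_take ?i \<alpha>) \<subseteq> psums \<beta> \<and> psums (comp_drop ?i \<alpha>) \<subseteq> psums \<gamma>"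
    unfolding psums_append psums_comp_take psums_comp_drop by (simp add: subset_iff) blast
  moreover have "\<beta> @ \<gamma> \<in> compositions" using assms by (simp add: compositions_def)
  ultimately show ?thesis
    using assms(4)
    by (auto simp: refines_iff_psums assms comp_take_in comp_drop_in
        sum_list_comp_take sum_list_comp_drop)
qed


text \<open>
  The two unit boxes on either side of position \<open>j > 0\<close>: a composition of 2 that remembers only
  whether \<open>j\<close> is a cut.
\<close>

definition window :: "nat \<Rightarrow> nat list \<Rightarrow> nat list"
  where "window j \<alpha> = comp_drop (j - 1) (comp_take (j + 1) \<alpha>)"

lemma one_in_psums_window:
  assumes "0 < j"
  shows "1 \<in> psums (window j \<alpha>) \<longleftrightarrow> j \<in> psums \<alpha>"
  using assms by (simp add: window_def in_psums_comp_drop psums_comp_take)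

lemma window_in: "window j \<alpha> \<in> compositions"
  by (simp add: window_def comp_drop_in)

lemma sum_list_window: "0 < j \<Longrightarrow> sum_list (window j \<alpha>) = 2"
  by (simp add: window_def sum_list_comp_drop sum_list_comp_take)

lemma compositions_of_two:
  assumes "\<alpha> \<in> compositions" "sum_list \<alpha> = 2"
  shows "\<alpha> = (if 1 \<in> psums \<alpha> then [1, 1] else [2])"
proof (rule psums_inject)
  have *: "x \<in> psums \<alpha> \<longleftrightarrow> x = 0 \<or> x = 2 \<or> x = 1 \<and> 1 \<in> psums \<alpha>" for x
  proof (cases "x \<le> 2")
    case True
    then have "x = 0 \<or> x = 1 \<or> x = 2" by linarith
    then show ?thesis using sum_list_in_psums[of \<alpha>] assms(2) by auto
  next
    case False
    then show ?thesis using psums_le[of x \<alpha>] assms(2) by auto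
  qed
  show "psums \<alpha> = psums (if 1 \<in> psums \<alpha> then [1, 1] else [2])"
  proof (rule set_eqI)
    show "x \<in> psums \<alpha> \<longleftrightarrow> x \<in> psums (if 1 \<in> psums \<alpha> then [1, 1] else [2])" for x
      by (cases "1 \<in> psums \<alpha>") (use *[of x] in auto)
  qed
qed (use assms in \<open>auto simp: compositions_def\<close>)


section \<open>The monomial and the fundamental basis\<close>

lemma mcoeff_add: "mcoeff (f + g) \<alpha> = mcoeff f \<alpha> + mcoeff g \<alpha>"
  by (simp add: mcoeff_def plus_qsym.rep_eq)

lemma mcoeff_scale: "mcoeff (c *\<^sub>Q f) \<alpha> = c * mcoeff f \<alpha>"
  by (simp add: mcoeff_def scaleQ_qsym.rep_eq)

lemma linear_mcoeff: "linearQ (\<lambda>f. mcoeff f \<alpha>)"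
  by (rule linearQ_I) (simp_all add: mcoeff_add mcoeff_scale scaleQ_rat_def)

lemma finite_refinements: "finite {\<beta> \<in> compositions. refines \<beta> \<alpha>}"
proof (rule finite_subset)
  have "sum_list (concat bs) = sum_list (map sum_list bs)" for bs :: "nat list list"
    by (induction bs) auto
  then show "{\<beta> \<in> compositions. refines \<beta> \<alpha>} \<subseteq> {\<beta> \<in> compositions. sum_list \<beta> \<le> sum_list \<alpha>}"
    by (auto simp: refines_def)
  show "finite {\<beta> \<in> compositions. sum_list \<beta> \<le> sum_list \<alpha>}" by (rule finite_compositions)
qed

lemma mcoeff_fundamental:
  assumes "\<alpha> \<in> compositions" "\<beta> \<in> compositions"
  shows "mcoeff (fundamental_qsym \<alpha>) \<beta> = (if refines \<beta> \<alpha> then 1 else 0)"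
proof -
  interpret m: Vector_Spaces.linear scaleQ scaleQ "\<lambda>f. mcoeff f \<beta>" by (rule linear_mcoeff)
  have "mcoeff (fundamental_qsym \<alpha>) \<beta>
      = (\<Sum>\<gamma> | \<gamma> \<in> compositions \<and> refines \<gamma> \<alpha>. if \<gamma> = \<beta> then 1 else 0)"
    unfolding fundamental_qsym_def m.sum
    by (rule sum.cong) (use mcoeff_monomial assms in auto)
  then show ?thesis using finite_refinements[of \<alpha>] assms by simp
qed


lemma monomial_cases:
  obtains \<alpha> "is" where "\<alpha> \<in> compositions" "is \<in> index_lists (length \<alpha>)" "m = mono_of is \<alpha>"
proof -
  define is\<^sub>m where "is\<^sub>m = sorted_list_of_set (Poly_Mapping.keys m)"
  define \<alpha> where "\<alpha> = map (Poly_Mapping.lookup m) is\<^sub>m"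
  have set: "set is\<^sub>m = Poly_Mapping.keys m" by (simp add: is\<^sub>m_def)
  then have "\<alpha> \<in> compositions"
    by (auto simp: \<alpha>_def compositions_def in_keys_iff)
  moreover have index: "is\<^sub>m \<in> index_lists (length \<alpha>)"
    by (simp add: index_lists_def \<alpha>_def is\<^sub>m_def)
  moreover have "m = mono_of is\<^sub>m \<alpha>"
  proof (rule poly_mapping_eqI)
    fix k
    show "Poly_Mapping.lookup m k = Poly_Mapping.lookup (mono_of is\<^sub>m \<alpha>) k"
    proof (cases "k \<in> set is\<^sub>m")
      case True
      then obtain j where "j < length is\<^sub>m" "k = is\<^sub>m ! j" by (metis in_set_conv_nth)
      then show ?thesis using lookup_mono_of_nth[OF index, of j] by (simp add: \<alpha>_def)
    next
      case False
      then show ?thesis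
        using lookup_mono_of_notin[of "is\<^sub>m" \<alpha> k] set by (simp add: \<alpha>_def in_keys_iff)
    qed
  qed
  ultimately show thesis by (rule that)
qed

lemma qsym_eqI:
  assumes "\<And>\<alpha>. \<alpha> \<in> compositions \<Longrightarrow> mcoeff f \<alpha> = mcoeff g \<alpha>"
  shows "f = g"
proof -
  have coeff: "qcoeff h (mono_of is \<alpha>) = mcoeff h \<alpha>"
    if "\<alpha> \<in> compositions" "is \<in> index_lists (length \<alpha>)" for h \<alpha> "is"
    using qcoeff[of h] that upt_index_list[of "length \<alpha>"]
    unfolding quasisymmetric_def mcoeff_def by blast
  have "qcoeff f m = qcoeff g m" for m
    by (rule monomial_cases[of m]) (simp add: coeff assms)
  then show ?thesis by (simp add: qcoeff_inject[symmetric] fun_eq_iff)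
qed

lemma span_monomial: "f \<in> ratvec.span (monomial_qsym ` compositions)"
proof -
  let ?S = "{\<alpha>. \<alpha> \<in> compositions \<and> mcoeff f \<alpha> \<noteq> 0}"
  let ?g = "\<Sum>\<alpha>\<in>?S. mcoeff f \<alpha> *\<^sub>Q monomial_qsym \<alpha>"
  have "f = ?g"
  proof (rule qsym_eqI)
    fix \<beta> assume \<beta>: "\<beta> \<in> compositions"
    interpret m: Vector_Spaces.linear scaleQ scaleQ "\<lambda>f. mcoeff f \<beta>" by (rule linear_mcoeff)
    have "mcoeff ?g \<beta> = (\<Sum>\<alpha>\<in>?S. if \<alpha> = \<beta> then mcoeff f \<beta> else 0)"
      unfolding m.sum mcoeff_scale
      by (rule sum.cong) (use \<beta> in \<open>auto simp: mcoeff_monomial\<close>)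
    also have "\<dots> = mcoeff f \<beta>" using finite_mcoeff[of f] \<beta> by simp
    finally show "mcoeff f \<beta> = mcoeff ?g \<beta>" by simp
  qed
  moreover have "?g \<in> ratvec.span (monomial_qsym ` compositions)"
    by (intro ratvec.span_sum ratvec.span_scale ratvec.span_base) auto
  ultimately show ?thesis by simp
qed

text \<open>
  In \<open>F\<^sub>\<alpha> = M\<^sub>\<alpha> + \<dots>\<close> the remaining terms are indexed by compositions with strictly more cuts, so
  that \<open>M\<^sub>\<alpha>\<close> can be solved for by induction on the number of missing cuts.
\<close>

lemma monomial_in_span_fundamental:
  assumes "\<alpha> \<in> compositions"
  shows "monomial_qsym \<alpha> \<in> ratvec.span fundamental_basis"
  using assms
proof (induction "card ({..sum_list \<alpha>} - psums \<alpha>)" arbitrary: \<alpha> rule: less_induct)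
  case less
  let ?R = "{\<beta> \<in> compositions. refines \<beta> \<alpha>}"
  have "\<alpha> \<in> ?R" using less.prems by (simp add: refines_iff_psums)
  then have "fundamental_qsym \<alpha> = monomial_qsym \<alpha> + (\<Sum>\<beta>\<in>?R - {\<alpha>}. monomial_qsym \<beta>)"
    unfolding fundamental_qsym_def using finite_refinements by (rule sum.remove[rotated])
  then have "monomial_qsym \<alpha> = fundamental_qsym \<alpha> - (\<Sum>\<beta>\<in>?R - {\<alpha>}. monomial_qsym \<beta>)"
    by (simp add: algebra_simps)
  moreover have "monomial_qsym \<beta> \<in> ratvec.span fundamental_basis" if "\<beta> \<in> ?R - {\<alpha>}" for \<beta>
  proof -
    from that have \<beta>: "\<beta> \<in> compositions" "sum_list \<beta> = sum_list \<alpha>" "psums \<alpha> \<subseteq> psums \<beta>"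
      using less.prems by (auto simp: refines_iff_psums)
    moreover have "psums \<alpha> \<noteq> psums \<beta>" using that less.prems psums_inject by auto
    ultimately obtain x where "x \<in> psums \<beta> - psums \<alpha>" by blast
    then have "{..sum_list \<beta>} - psums \<beta> \<subset> {..sum_list \<alpha>} - psums \<alpha>"
      using \<beta> psums_le[of x \<beta>] by auto
    then have "card ({..sum_list \<beta>} - psums \<beta>) < card ({..sum_list \<alpha>} - psums \<alpha>)"
      by (intro psubset_card_mono) simp_all
    then show ?thesis using less.hyps \<beta>(1) by blast
  qed
  ultimately show ?case
    using less.prems
    by (auto simp: fundamental_basis_def
        intro!: ratvec.span_diff ratvec.span_sum intro: ratvec.span_base)
qed

lemma span_fundamental_basis: "ratvec.span fundamental_basis = UNIV"
proof -
  have "ratvec.span (monomial_qsym ` compositions) \<subseteq> ratvec.span fundamental_basis"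
    by (rule ratvec.span_minimal) (auto intro: monomial_in_span_fundamental)
  then show ?thesis using span_monomial by blast
qed

lemma ratvec_pair:
  "vector_space_pair (scaleQ :: rat \<Rightarrow> 'a \<Rightarrow> 'a::rat_vector) (scaleQ :: rat \<Rightarrow> 'b \<Rightarrow> 'b::rat_vector)"
  by unfold_locales

lemma linearQ_sum:
  assumes "linearQ f"
  shows "f (\<Sum>i\<in>I. x i) = (\<Sum>i\<in>I. f (x i))"
proof -
  interpret Vector_Spaces.linear scaleQ scaleQ f by fact
  show ?thesis by (rule sum)
qed

lemma linear_eq_if_eq_on_fundamental:
  assumes "linearQ f" "linearQ g"
    and "\<And>\<alpha>. \<alpha> \<in> compositions \<Longrightarrow> f (fundamental_qsym \<alpha>) = g (fundamental_qsym \<alpha>)"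
  shows "f = g"
proof
  fix x :: qsym
  show "f x = g x"
  proof (rule vector_space_pair.linear_eq_on[OF ratvec_pair assms(1,2)])
    show "x \<in> ratvec.span fundamental_basis" by (simp add: span_fundamental_basis)
  qed (auto simp: fundamental_basis_def assms(3))
qed

text \<open>
  The coefficient of \<open>M\<^sub>\<alpha>\<close> takes the value 1 on \<open>F\<^sub>\<beta>\<close> exactly for those \<open>\<beta>\<close> that \<open>\<alpha>\<close> refines.
  Subtracting the functionals dual to the \<open>\<beta> \<noteq> \<alpha>\<close> among them, which have fewer cuts, leaves the
  functional dual to \<open>F\<^sub>\<alpha>\<close>. This recursion replaces the explicit alternating sum of Moebius
  inversion.
\<close>

lemma dual_functional_exists:
  assumes "\<alpha> \<in> compositions"
  shows "\<exists>c. linearQ c \<and>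
    (\<forall>\<beta>\<in>compositions. c (fundamental_qsym \<beta>) = (if \<beta> = \<alpha> then 1 else 0 :: rat))"
  using assms
proof (induction "card (psums \<alpha>)" arbitrary: \<alpha> rule: less_induct)
  case less
  let ?S = "{\<beta> \<in> compositions. refines \<alpha> \<beta> \<and> \<beta> \<noteq> \<alpha>}"
  have S: "\<beta> \<in> compositions" "sum_list \<beta> = sum_list \<alpha>" "psums \<beta> \<subseteq> psums \<alpha>" "\<beta> \<noteq> \<alpha>"
    if "\<beta> \<in> ?S" for \<beta>
    using that less.prems by (auto simp: refines_iff_psums)
  have "\<exists>c. linearQ c \<and>
      (\<forall>\<gamma>\<in>compositions. c (fundamental_qsym \<gamma>) = (if \<gamma> = \<beta> then 1 else 0 :: rat))"
    if "\<beta> \<in> ?S" for \<beta>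
  proof (rule less.hyps)
    have "psums \<beta> \<noteq> psums \<alpha>" using S[OF that] less.prems psums_inject by blast
    then show "card (psums \<beta>) < card (psums \<alpha>)"
      using S(3)[OF that] by (simp add: psubset_card_mono psubset_eq)
  qed (use that in blast)
  from bchoice[OF ballI[OF this]] obtain d where d: "\<forall>\<beta>\<in>?S. linearQ (d \<beta>) \<and>
      (\<forall>\<gamma>\<in>compositions. d \<beta> (fundamental_qsym \<gamma>) = (if \<gamma> = \<beta> then 1 else 0 :: rat))" ..
  have d_linear: "linearQ (d \<beta>)" if "\<beta> \<in> ?S" for \<beta>
    by (rule conjunct1[OF bspec[OF d that]])
  have d_fundamental:
    "d \<beta> (fundamental_qsym \<gamma>) = (if \<gamma> = \<beta> then 1 else 0)"
    if "\<beta> \<in> ?S" "\<gamma> \<in> compositions" for \<beta> \<gamma>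
    by (rule bspec[OF conjunct2[OF bspec[OF d that(1)]] that(2)])
  have fin: "finite ?S"
  proof (rule finite_subset[OF subsetI finite_compositions[of "sum_list \<alpha>"]])
    show "\<beta> \<in> {\<beta> \<in> compositions. sum_list \<beta> \<le> sum_list \<alpha>}" if "\<beta> \<in> ?S" for \<beta>
      using S(1,2)[OF that] by simp
  qed
  let ?c = "\<lambda>f. mcoeff f \<alpha> - (\<Sum>\<beta>\<in>?S. d \<beta> f)"
  have "linearQ ?c"
  proof (rule linearQ_I)
    show "?c (f + g) = ?c f + ?c g" for f g
      using d_linear by (simp add: mcoeff_add Vector_Spaces.linear_iff sum.distrib)
    show "?c (r *\<^sub>Q f) = r *\<^sub>Q ?c f" for r f
      using d_linear by (simp add: mcoeff_scale Vector_Spaces.linear_iff scaleQ_rat_def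
          sum_distrib_left right_diff_distrib)
  qed
  moreover have "?c (fundamental_qsym \<beta>) = (if \<beta> = \<alpha> then 1 else 0)"
    if \<beta>: "\<beta> \<in> compositions" for \<beta>
  proof -
    have "(\<Sum>\<gamma>\<in>?S. d \<gamma> (fundamental_qsym \<beta>)) = (\<Sum>\<gamma>\<in>?S. if \<beta> = \<gamma> then 1 else 0)"
      by (rule sum.cong) (simp_all add: d_fundamental \<beta>)
    also have "\<dots> = (if \<beta> \<in> ?S then 1 else 0)" using fin by simp
    moreover have "refines \<alpha> \<alpha>" using less.prems by (simp add: refines_iff_psums)
    ultimately show ?thesis using \<beta> less.prems by (auto simp: mcoeff_fundamental)
  qed
  ultimately show ?case by blast
qed

definition fcoeff :: "nat list \<Rightarrow> qsym \<Rightarrow> rat"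
  where "fcoeff \<alpha> = (SOME c. linearQ c \<and>
    (\<forall>\<beta>\<in>compositions. c (fundamental_qsym \<beta>) = (if \<beta> = \<alpha> then 1 else 0)))"

lemma
  assumes "\<alpha> \<in> compositions"
  shows linear_fcoeff: "linearQ (fcoeff \<alpha>)"
    and fcoeff_fundamental: "\<beta> \<in> compositions \<Longrightarrow>
      fcoeff \<alpha> (fundamental_qsym \<beta>) = (if \<beta> = \<alpha> then 1 else 0)"
  using someI_ex[OF dual_functional_exists[OF assms]] by (simp_all add: fcoeff_def)

lemma inj_on_fundamental: "inj_on fundamental_qsym compositions"
proof (rule inj_onI)
  fix \<alpha> \<beta>
  assume \<alpha>: "\<alpha> \<in> compositions" and \<beta>: "\<beta> \<in> compositions"
    and eq: "fundamental_qsym \<alpha> = fundamental_qsym \<beta>"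
  show "\<alpha> = \<beta>"
    using fcoeff_fundamental[OF \<beta> \<alpha>] fcoeff_fundamental[OF \<beta> \<beta>]
    unfolding eq by (simp split: if_splits)
qed

lemma independent_fundamental_basis: "ratvec.independent fundamental_basis"
  unfolding ratvec.independent_explicit_module
proof (intro allI impI)
  fix T u v
  assume T: "finite T" "T \<subseteq> fundamental_basis" "(\<Sum>v\<in>T. u v *\<^sub>Q v) = 0" "v \<in> T"
  then obtain \<alpha> where \<alpha>: "\<alpha> \<in> compositions" "v = fundamental_qsym \<alpha>"
    by (auto simp: fundamental_basis_def)
  interpret c: Vector_Spaces.linear scaleQ scaleQ "fcoeff \<alpha>" using \<alpha>(1) by (rule linear_fcoeff)
  have "fcoeff \<alpha> w = (if w = v then 1 else 0)" if "w \<in> T" for w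
    using that T(2) \<alpha> by (auto simp: fundamental_basis_def fcoeff_fundamental)
  then have "fcoeff \<alpha> (\<Sum>w\<in>T. u w *\<^sub>Q w) = (\<Sum>w\<in>T. if w = v then u v else 0)"
    unfolding c.sum c.scale scaleQ_rat_def by (intro sum.cong) auto
  then show "u v = 0" using T by (simp add: c.zero)
qed

text \<open>
  The dual functional of \<open>F\<^sub>\<alpha>\<close> vanishes on the spans of all degrees other than that of \<open>\<alpha>\<close>.
\<close>

lemma sum_list_eq_if_fundamental_in_degree:
  assumes "\<alpha> \<in> compositions" "fundamental_qsym \<alpha> \<in> qsym_degree n"
  shows "sum_list \<alpha> = n"
proof (rule ccontr)
  assume neq: "sum_list \<alpha> \<noteq> n"
  have "fcoeff \<alpha> (fundamental_qsym \<alpha>) = (\<lambda>_ :: qsym. 0 :: rat) (fundamental_qsym \<alpha>)"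
  proof (rule vector_space_pair.linear_eq_on[OF ratvec_pair linear_fcoeff[OF assms(1)]])
    show "linearQ (\<lambda>_ :: qsym. 0 :: rat)"
      by (rule linearQ_I) simp_all
    show "fundamental_qsym \<alpha> \<in> ratvec.span (fundamental_qsym ` {\<alpha> \<in> compositions. sum_list \<alpha> = n})"
      using assms(2) by (simp add: qsym_degree_def)
  qed (use neq assms(1) in \<open>auto simp: fcoeff_fundamental\<close>)
  then show False using assms(1) by (simp add: fcoeff_fundamental)
qed


section \<open>The coproduct of a fundamental quasisymmetric function\<close>

lemma linear_tensor_prod_left: "linearQ (\<lambda>u. u \<otimes> v)"
  by (rule linearQ_I) (rule tensor_prod_add_left tensor_prod_scale_left)+

lemma linear_tensor_prod_right: "linearQ (\<lambda>v. u \<otimes> v)"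
  by (rule linearQ_I) (rule tensor_prod_add_right tensor_prod_scale_right)+

lemma tensor_prod_sum:
  "(\<Sum>i\<in>I. f i) \<otimes> (\<Sum>j\<in>J. g j) = (\<Sum>(i, j)\<in>I \<times> J. f i \<otimes> g j)"
  unfolding linearQ_sum[OF linear_tensor_prod_left]
  unfolding linearQ_sum[OF linear_tensor_prod_right] sum.cartesian_product ..

text \<open>
  Both sides expand into the tensors \<open>M\<^sub>\<beta> \<otimes> M\<^sub>\<gamma>\<close> over all pairs such that \<open>\<beta> @ \<gamma>\<close> refines \<open>\<alpha>\<close>: on the
  left they are grouped by \<open>\<beta> @ \<gamma>\<close>, on the right by the position \<open>sum_list \<beta>\<close>
  (\<open>refines_append_iff\<close>).
\<close>

lemma comult_fundamental:
  assumes \<alpha>: "\<alpha> \<in> compositions"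
  shows "comult (fundamental_qsym \<alpha>) =
    (\<Sum>i\<le>sum_list \<alpha>. fundamental_qsym (comp_take i \<alpha>) \<otimes> fundamental_qsym (comp_drop i \<alpha>))"
proof -
  let ?R = "\<lambda>\<alpha>. {\<beta>. \<beta> \<in> compositions \<and> refines \<beta> \<alpha>}"
  let ?D = "\<lambda>\<delta> :: nat list. {(\<beta>, \<gamma>). \<beta> @ \<gamma> = \<delta>}"
  let ?M = "\<lambda>(\<beta>, \<gamma>). monomial_qsym \<beta> \<otimes> monomial_qsym \<gamma>"
  let ?C = "\<lambda>i. ?R (comp_take i \<alpha>) \<times> ?R (comp_drop i \<alpha>)"
  have finite_D: "finite (?D \<delta>)" for \<delta>
  proof (rule finite_subset)
    have "(\<beta>, \<gamma>) \<in> (\<lambda>k. (take k \<delta>, drop k \<delta>)) ` {..length \<delta>}" if "\<beta> @ \<gamma> = \<delta>" for \<beta> \<gamma>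
      by (rule image_eqI[of _ _ "length \<beta>"]) (use that in auto)
    then show "?D \<delta> \<subseteq> (\<lambda>k. (take k \<delta>, drop k \<delta>)) ` {..length \<delta>}" by blast
  qed simp
  have finite_R: "finite (?R \<beta>)" for \<beta>
    by (rule finite_refinements)
  have "comult (fundamental_qsym \<alpha>) = (\<Sum>\<delta>\<in>?R \<alpha>. \<Sum>p\<in>?D \<delta>. ?M p)"
    unfolding fundamental_qsym_def linearQ_sum[OF linear_comult]
    by (rule sum.cong) (simp_all add: comult_monomial)
  also have "\<dots> = (\<Sum>(\<delta>, p)\<in>Sigma (?R \<alpha>) ?D. ?M p)"
    by (rule sum.Sigma) (use finite_D finite_R in auto)
  also have "\<dots> = (\<Sum>(i, p)\<in>Sigma {..sum_list \<alpha>} ?C. ?M p)"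
  proof (rule sum.reindex_bij_witness[where
        i = "\<lambda>(i, \<beta>, \<gamma>). (\<beta> @ \<gamma>, \<beta>, \<gamma>)" and j = "\<lambda>(\<delta>, \<beta>, \<gamma>). (sum_list \<beta>, \<beta>, \<gamma>)"])
    fix x assume "x \<in> Sigma (?R \<alpha>) ?D"
    then obtain \<beta> \<gamma> where x: "x = (\<beta> @ \<gamma>, \<beta>, \<gamma>)" and r: "refines (\<beta> @ \<gamma>) \<alpha>"
      and "\<beta> @ \<gamma> \<in> compositions" by auto
    then have in_comp: "\<beta> @ \<gamma> \<in> compositions" "\<beta> \<in> compositions" "\<gamma> \<in> compositions"
      by (simp_all add: compositions_def)
    have "sum_list \<beta> \<le> sum_list \<alpha>"
      using r unfolding refines_iff_psums[OF \<alpha> in_comp(1)] sum_list_append by linarith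
    then show "(case x of (\<delta>, \<beta>, \<gamma>) \<Rightarrow> (sum_list \<beta>, \<beta>, \<gamma>)) \<in> Sigma {..sum_list \<alpha>} ?C"
      using r in_comp refines_append_iff[OF \<alpha> in_comp(2,3)] by (simp add: x)
  next
    fix x assume "x \<in> Sigma {..sum_list \<alpha>} ?C"
    then obtain i \<beta> \<gamma> where x: "x = (i, \<beta>, \<gamma>)" "i \<le> sum_list \<alpha>"
      and in_comp: "\<beta> \<in> compositions" "\<gamma> \<in> compositions"
      and r: "refines \<beta> (comp_take i \<alpha>)" "refines \<gamma> (comp_drop i \<alpha>)" by auto
    have i: "sum_list \<beta> = i"
      using r(1) in_comp by (simp add: refines_iff_psums comp_take_in sum_list_comp_take)
    then show "(case case x of (i, \<beta>, \<gamma>) \<Rightarrow> (\<beta> @ \<gamma>, \<beta>, \<gamma>) of (\<delta>, \<beta>, \<gamma>) \<Rightarrow> (sum_list \<beta>, \<beta>, \<gamma>)) = x"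
      by (simp add: x)
    have "\<beta> @ \<gamma> \<in> compositions" using in_comp by (simp add: compositions_def)
    then show "(case x of (i, \<beta>, \<gamma>) \<Rightarrow> (\<beta> @ \<gamma>, \<beta>, \<gamma>)) \<in> Sigma (?R \<alpha>) ?D"
      using r refines_append_iff[OF \<alpha> in_comp] x(2) i by (simp add: x(1))
  qed auto
  also have "\<dots> = (\<Sum>i\<le>sum_list \<alpha>. \<Sum>p\<in>?C i. ?M p)"
    by (rule sum.Sigma[symmetric]) (use finite_R in auto)
  also have "\<dots> = (\<Sum>i\<le>sum_list \<alpha>.
      fundamental_qsym (comp_take i \<alpha>) \<otimes> fundamental_qsym (comp_drop i \<alpha>))"
    unfolding fundamental_qsym_def tensor_prod_sum ..
  finally show ?thesis .
qed

lemma counit_fundamental: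
  assumes "\<alpha> \<in> compositions"
  shows "counit (fundamental_qsym \<alpha>) = (if \<alpha> = [] then 1 else 0)"
proof -
  have "[] \<in> compositions" by (simp add: compositions_def)
  moreover have "refines [] \<alpha> \<longleftrightarrow> \<alpha> = []"
  proof
    assume "refines [] \<alpha>"
    then obtain bs where "[] = concat bs" "[] \<notin> set bs" "\<alpha> = map sum_list bs"
      unfolding refines_def by blast
    then show "\<alpha> = []" by (cases bs) auto
  qed (simp add: refines_def)
  ultimately show ?thesis using assms by (simp add: counit_def mcoeff_fundamental)
qed


section \<open>Evaluating tensors\<close>

text \<open>
  The functional \<open>f \<otimes> g\<close> on a tensor product, followed by multiplication of rationals. For linear
  \<open>f\<close> and \<open>g\<close> its value does not depend on the representative chosen by \<open>rep_tensor\<close>.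
\<close>

definition tensor_eval ::
    "('a::rat_vector \<Rightarrow> rat) \<Rightarrow> ('b::rat_vector \<Rightarrow> rat) \<Rightarrow> ('a, 'b) tensor \<Rightarrow> rat"
  where "tensor_eval f g t = free_extend (\<lambda>(u, v). f u * g v) (rep_tensor t)"

lemma
  assumes "linearQ f" "linearQ g"
  shows linear_tensor_eval: "linearQ (tensor_eval f g)"
    and tensor_eval_prod: "tensor_eval f g (u \<otimes> v) = f u * g v"
proof -
  interpret f: Vector_Spaces.linear scaleQ scaleQ f by fact
  interpret g: Vector_Spaces.linear scaleQ scaleQ g by fact
  have abs: "tensor_eval f g (abs_tensor p) = free_extend (\<lambda>(u, v). f u * g v) p" for p
  proof -
    have "tensor_rel (rep_tensor (abs_tensor p)) p"
      using Quotient3_rep_abs[OF Quotient3_tensor] equivp_reflp[OF equivp_tensor_rel] by blast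
    then show ?thesis
      unfolding tensor_eval_def
      by (intro free_extend_respects)
         (simp_all add: f.add g.add f.scale g.scale scaleQ_rat_def algebra_simps)
  qed
  show "tensor_eval f g (u \<otimes> v) = f u * g v"
    by (simp add: tensor_prod.abs_eq abs free_extend_single scaleQ_rat_def)
  show "linearQ (tensor_eval f g)"
  proof (rule linearQ_I)
    fix s t :: "('a, 'b) tensor" and c
    obtain p q where st: "s = abs_tensor p" "t = abs_tensor q"
      by (induction s rule: tensor.abs_induct, induction t rule: tensor.abs_induct) blast
    show "tensor_eval f g (s + t) = tensor_eval f g s + tensor_eval f g t"
      by (simp add: st plus_tensor.abs_eq abs free_extend_add)
    show "tensor_eval f g (c *\<^sub>Q s) = c *\<^sub>Q tensor_eval f g s"
      by (simp add: st scaleQ_tensor.abs_eq abs free_extend_scale)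
  qed
qed


section \<open>Complementation is a graded coalgebra automorphism\<close>

lemma complement_map_exists:
  "\<exists>\<Psi>. linearQ \<Psi> \<and> (\<forall>\<alpha>\<in>compositions. \<Psi> (fundamental_qsym \<alpha>) = fundamental_qsym (comp_compl \<alpha>))"
proof -
  let ?f = "\<lambda>x. fundamental_qsym (comp_compl (inv_into compositions fundamental_qsym x))"
  have "\<exists>\<Psi>. linearQ \<Psi> \<and> (\<forall>x\<in>fundamental_basis. \<Psi> x = ?f x)"
    by (rule vector_space_pair.linear_independent_extend[OF ratvec_pair independent_fundamental_basis])
  then show ?thesis
    by (elim ex_forward) (simp add: fundamental_basis_def inv_into_f_f[OF inj_on_fundamental])
qed

context
  fixes \<Psi> :: "qsym \<Rightarrow> qsym"
  assumes linear: "linearQ \<Psi>"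
    and compl: "\<alpha> \<in> compositions \<Longrightarrow> \<Psi> (fundamental_qsym \<alpha>) = fundamental_qsym (comp_compl \<alpha>)"
begin

lemma complement_map_involution: "\<Psi> \<circ> \<Psi> = id"
  by (rule linear_eq_if_eq_on_fundamental[OF Vector_Spaces.linear_compose[OF linear linear]])
     (simp_all add: compl comp_compl_in comp_compl_comp_compl ratvec.linear_id)

lemma coalgebra_hom_complement_map: "coalgebra_hom \<Psi>"
proof -
  have "comult \<circ> \<Psi> = tensor_map \<Psi> \<Psi> \<circ> comult"
  proof (rule linear_eq_if_eq_on_fundamental)
    fix \<alpha> assume \<alpha>: "\<alpha> \<in> compositions"
    show "(comult \<circ> \<Psi>) (fundamental_qsym \<alpha>) = (tensor_map \<Psi> \<Psi> \<circ> comult) (fundamental_qsym \<alpha>)"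
      using \<alpha>
      by (simp add: compl comult_fundamental comp_compl_in sum_list_comp_compl
          linearQ_sum[OF linear_tensor_map[OF linear linear]]
          tensor_map_prod[OF linear linear] comp_take_in comp_drop_in
          comp_take_comp_compl comp_drop_comp_compl)
  qed (rule Vector_Spaces.linear_compose[OF linear linear_comult]
      Vector_Spaces.linear_compose[OF linear_comult linear_tensor_map[OF linear linear]])+
  moreover have "counit \<circ> \<Psi> = counit"
  proof (rule linear_eq_if_eq_on_fundamental)
    have counit: "linearQ counit" unfolding counit_def by (rule linear_mcoeff)
    then show "linearQ counit" "linearQ (counit \<circ> \<Psi>)"
      by (assumption, rule Vector_Spaces.linear_compose[OF linear])
    fix \<alpha> assume \<alpha>: "\<alpha> \<in> compositions"
    have "comp_compl \<alpha> = [] \<longleftrightarrow> \<alpha> = []"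
      using comp_compl_comp_compl[OF \<alpha>] comp_compl_Nil by auto
    then show "(counit \<circ> \<Psi>) (fundamental_qsym \<alpha>) = counit (fundamental_qsym \<alpha>)"
      using \<alpha> by (simp add: compl counit_fundamental comp_compl_in)
  qed
  ultimately show ?thesis
    using linear by (simp add: coalgebra_hom_def fun_eq_iff)
qed

lemma graded_complement_map: "graded \<Psi>"
  unfolding graded_def
proof
  fix n
  let ?F = "fundamental_qsym ` {\<alpha> \<in> compositions. sum_list \<alpha> = n}"
  have "\<Psi> ` ratvec.span ?F = ratvec.span (\<Psi> ` ?F)"
    by (rule module_hom.span_image[symmetric])
       (use linear in \<open>simp add: Vector_Spaces.linear_iff_module_hom\<close>)
  also have "\<dots> \<subseteq> ratvec.span ?F"
    by (rule ratvec.span_mono) (auto simp: compl comp_compl_in sum_list_comp_compl)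
  finally show "\<Psi> ` qsym_degree n \<subseteq> qsym_degree n" by (simp add: qsym_degree_def)
qed

lemma graded_coalgebra_aut_complement_map: "graded_coalgebra_aut \<Psi>"
proof -
  have "\<Psi> (\<Psi> x) = x" for x using fun_cong[OF complement_map_involution, of x] by simp
  then have "bij \<Psi>" "inv \<Psi> = \<Psi>"
    by (auto intro: o_bij[OF complement_map_involution complement_map_involution] inv_equality)
  then show ?thesis
    by (simp add: graded_coalgebra_aut_def coalgebra_hom_complement_map graded_complement_map)
qed

lemma complement_map_image_fundamental_basis: "\<Psi> ` fundamental_basis = fundamental_basis"
proof -
  have "comp_compl ` compositions = compositions"
  proof (intro equalityI subsetI)
    show "\<alpha> \<in> comp_compl ` compositions" if "\<alpha> \<in> compositions" for \<alpha>
      using that by (intro image_eqI[of _ _ "comp_compl \<alpha>"])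
        (simp_all add: comp_compl_in comp_compl_comp_compl)
  qed (auto simp: comp_compl_in)
  then have "fundamental_qsym ` comp_compl ` compositions = fundamental_basis"
    by (simp add: fundamental_basis_def)
  moreover have "\<Psi> ` fundamental_basis = fundamental_qsym ` comp_compl ` compositions"
    unfolding fundamental_basis_def image_image by (rule image_cong) (simp_all add: compl)
  ultimately show ?thesis by simp
qed

lemma complement_map_neq_id: "\<Psi> \<noteq> id"
proof
  assume "\<Psi> = id"
  \<comment> \<open>Complementation fixes \<open>[]\<close> and \<open>[1]\<close>, so the least witness has size 2.\<close>
  have two: "[2] \<in> compositions" by (simp add: compositions_def)
  with compl[OF this] \<open>\<Psi> = id\<close> have "[2] = comp_compl [2]"
    using inj_on_fundamental by (simp add: inj_on_def comp_compl_in)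
  then have "1 \<in> psums [2] \<longleftrightarrow> 1 \<in> psums (comp_compl [2])" by simp
  then show False using two by (simp add: psums_comp_compl)
qed

end


section \<open>Uniqueness\<close>

text \<open>
  The permutation of the basis is carried along as a map \<open>\<sigma>\<close> of compositions, so that the rest of
  the argument is combinatorial.
\<close>

locale basis_permuting_aut =
  fixes \<Phi> :: "qsym \<Rightarrow> qsym" and \<sigma> :: "nat list \<Rightarrow> nat list"
  assumes aut: "graded_coalgebra_aut \<Phi>"
    and \<sigma>_in: "\<alpha> \<in> compositions \<Longrightarrow> \<sigma> \<alpha> \<in> compositions"
    and \<Phi>_fundamental: "\<alpha> \<in> compositions \<Longrightarrow> \<Phi> (fundamental_qsym \<alpha>) = fundamental_qsym (\<sigma> \<alpha>)"
begin

lemma linear: "linearQ \<Phi>"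
  using aut by (simp add: graded_coalgebra_aut_def coalgebra_hom_def)

lemma sum_list_\<sigma>:
  assumes "\<alpha> \<in> compositions"
  shows "sum_list (\<sigma> \<alpha>) = sum_list \<alpha>"
proof (rule sum_list_eq_if_fundamental_in_degree)
  have "fundamental_qsym \<alpha> \<in> qsym_degree (sum_list \<alpha>)"
    unfolding qsym_degree_def by (rule ratvec.span_base) (use assms in blast)
  then have "\<Phi> (fundamental_qsym \<alpha>) \<in> qsym_degree (sum_list \<alpha>)"
    using aut unfolding graded_coalgebra_aut_def graded_def by blast
  then show "fundamental_qsym (\<sigma> \<alpha>) \<in> qsym_degree (sum_list \<alpha>)"
    by (simp add: \<Phi>_fundamental assms)
qed (rule \<sigma>_in[OF assms])

lemma inj_on_\<sigma>: "inj_on \<sigma> compositions"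
proof (rule inj_onI)
  fix \<alpha> \<beta> assume \<alpha>\<beta>: "\<alpha> \<in> compositions" "\<beta> \<in> compositions" and "\<sigma> \<alpha> = \<sigma> \<beta>"
  then have "\<Phi> (fundamental_qsym \<alpha>) = \<Phi> (fundamental_qsym \<beta>)" by (simp add: \<Phi>_fundamental)
  moreover have "inj \<Phi>" using aut by (simp add: graded_coalgebra_aut_def bij_is_inj)
  ultimately have "fundamental_qsym \<alpha> = fundamental_qsym \<beta>" by (simp add: inj_eq)
  then show "\<alpha> = \<beta>" using \<alpha>\<beta> inj_on_fundamental by (simp add: inj_on_def)
qed

text \<open>
  The functional dual to \<open>F(comp_take i (\<sigma> \<alpha>)) \<otimes> F(comp_drop i (\<sigma> \<alpha>))\<close> is applied to
  \<open>\<Delta>(\<Phi>(F\<^sub>\<alpha>)) = (\<Phi> \<otimes> \<Phi>)(\<Delta>(F\<^sub>\<alpha>))\<close>. On the left it picks out the \<open>i\<close>-th term and gives 1. On the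
  right a nonzero value forces some term to match, and the size of its left factor shows that this
  is the \<open>i\<close>-th one.
\<close>

lemma \<sigma>_cut:
  assumes \<alpha>: "\<alpha> \<in> compositions" and i: "i \<le> sum_list \<alpha>"
  shows \<sigma>_comp_take: "\<sigma> (comp_take i \<alpha>) = comp_take i (\<sigma> \<alpha>)"
    and \<sigma>_comp_drop: "\<sigma> (comp_drop i \<alpha>) = comp_drop i (\<sigma> \<alpha>)"
proof -
  let ?\<beta> = "comp_take i (\<sigma> \<alpha>)" and ?\<gamma> = "comp_drop i (\<sigma> \<alpha>)"
  let ?e = "tensor_eval (fcoeff ?\<beta>) (fcoeff ?\<gamma>)"
  have lin: "linearQ (fcoeff ?\<beta>)" "linearQ (fcoeff ?\<gamma>)"
    by (simp_all add: linear_fcoeff comp_take_in comp_drop_in)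
  note sum_e = linearQ_sum[OF linear_tensor_eval[OF lin]]
  have delta: "?e (fundamental_qsym \<delta> \<otimes> fundamental_qsym \<epsilon>) = (if \<delta> = ?\<beta> \<and> \<epsilon> = ?\<gamma> then 1 else 0)"
    if "\<delta> \<in> compositions" "\<epsilon> \<in> compositions" for \<delta> \<epsilon>
    using that by (simp add: tensor_eval_prod[OF lin] fcoeff_fundamental comp_take_in comp_drop_in)
  have take_eq: "comp_take k (\<sigma> \<alpha>) = ?\<beta> \<longleftrightarrow> k = i" for k
    using sum_list_comp_take by metis
  have \<sigma>_take_eq: "k = i" if "\<sigma> (comp_take k \<alpha>) = ?\<beta>" for k
    using that sum_list_\<sigma>[OF comp_take_in[of k \<alpha>]] by (simp add: sum_list_comp_take)
  have "?e (comult (\<Phi> (fundamental_qsym \<alpha>)))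
      = (\<Sum>k\<le>sum_list \<alpha>. if comp_take k (\<sigma> \<alpha>) = ?\<beta> \<and> comp_drop k (\<sigma> \<alpha>) = ?\<gamma> then 1 else 0)"
    by (simp add: \<Phi>_fundamental \<alpha> comult_fundamental \<sigma>_in sum_list_\<sigma> sum_e delta
        comp_take_in comp_drop_in)
  also have "\<dots> = (\<Sum>k\<le>sum_list \<alpha>. if k = i then 1 else 0)"
    by (rule sum.cong) (auto simp: take_eq)
  also have "\<dots> = 1" using i by simp
  finally have lhs: "?e (comult (\<Phi> (fundamental_qsym \<alpha>))) = 1" .
  have "comult (\<Phi> (fundamental_qsym \<alpha>)) = tensor_map \<Phi> \<Phi> (comult (fundamental_qsym \<alpha>))"
    using aut by (simp add: graded_coalgebra_aut_def coalgebra_hom_def)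
  also have "?e \<dots> =
      (\<Sum>k\<le>sum_list \<alpha>. if \<sigma> (comp_take k \<alpha>) = ?\<beta> \<and> \<sigma> (comp_drop k \<alpha>) = ?\<gamma> then 1 else 0)"
    by (simp add: comult_fundamental \<alpha> tensor_map_prod[OF linear linear] sum_e delta
        linearQ_sum[OF linear_tensor_map[OF linear linear]]
        \<Phi>_fundamental \<sigma>_in comp_take_in comp_drop_in)
  finally have "(\<Sum>k\<le>sum_list \<alpha>.
      if \<sigma> (comp_take k \<alpha>) = ?\<beta> \<and> \<sigma> (comp_drop k \<alpha>) = ?\<gamma> then 1 else 0 :: rat) \<noteq> 0"
    using lhs by simp
  then obtain k where
    "(if \<sigma> (comp_take k \<alpha>) = ?\<beta> \<and> \<sigma> (comp_drop k \<alpha>) = ?\<gamma> then 1 else 0 :: rat) \<noteq> 0"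
    by (rule sum.not_neutral_contains_not_neutral)
  then have "\<sigma> (comp_take k \<alpha>) = ?\<beta>" "\<sigma> (comp_drop k \<alpha>) = ?\<gamma>"
    by (simp_all split: if_splits)
  then show "\<sigma> (comp_take i \<alpha>) = ?\<beta>" "\<sigma> (comp_drop i \<alpha>) = ?\<gamma>"
    using \<sigma>_take_eq by blast+
qed

lemma \<sigma>_window:
  assumes "\<alpha> \<in> compositions" "0 < j" "j < sum_list \<alpha>"
  shows "\<sigma> (window j \<alpha>) = window j (\<sigma> \<alpha>)"
  using assms by (simp add: window_def \<sigma>_comp_take \<sigma>_comp_drop comp_take_in sum_list_comp_take)

text \<open>
  Being injective, \<open>\<sigma>\<close> fixes or exchanges the two compositions of 2, and the image of \<open>[1, 1]\<close>
  decides which.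
\<close>

lemma \<sigma>_of_two:
  assumes "\<alpha> \<in> compositions" "sum_list \<alpha> = 2"
  shows "1 \<in> psums (\<sigma> \<alpha>) \<longleftrightarrow> (1 \<in> psums \<alpha> \<longleftrightarrow> 1 \<in> psums (\<sigma> [1, 1]))"
proof -
  have two: "[1, 1] \<in> compositions" "[2] \<in> compositions" by (simp_all add: compositions_def)
  have sums: "sum_list (\<sigma> [1, 1]) = 2" "sum_list (\<sigma> [2]) = 2"
    using sum_list_\<sigma>[OF two(1)] sum_list_\<sigma>[OF two(2)] by simp_all
  have "\<sigma> [1, 1] \<noteq> \<sigma> [2]" using inj_on_\<sigma> two by (auto simp: inj_on_def)
  then have "1 \<in> psums (\<sigma> [2]) \<longleftrightarrow> 1 \<notin> psums (\<sigma> [1, 1])"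
    using compositions_of_two[OF \<sigma>_in[OF two(1)] sums(1)]
      compositions_of_two[OF \<sigma>_in[OF two(2)] sums(2)] by (auto split: if_splits)
  then show ?thesis using compositions_of_two[OF assms] by (metis (full_types))
qed

text \<open>
  Since \<open>\<sigma>\<close> commutes with taking windows, its effect at every inner position of every composition
  is the effect on compositions of 2.
\<close>

lemma in_psums_\<sigma>:
  assumes "\<alpha> \<in> compositions" "0 < j" "j < sum_list \<alpha>"
  shows "j \<in> psums (\<sigma> \<alpha>) \<longleftrightarrow> (j \<in> psums \<alpha> \<longleftrightarrow> 1 \<in> psums (\<sigma> [1, 1]))"
  using \<sigma>_of_two[OF window_in sum_list_window[OF assms(2)], of \<alpha>]
  unfolding \<sigma>_window[OF assms] one_in_psums_window[OF assms(2)] .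

lemma \<sigma>_eqI:
  assumes "\<alpha> \<in> compositions" "\<beta> \<in> compositions" "sum_list \<beta> = sum_list \<alpha>"
    and "\<And>j. 0 < j \<Longrightarrow> j < sum_list \<alpha> \<Longrightarrow> j \<in> psums (\<sigma> \<alpha>) \<longleftrightarrow> j \<in> psums \<beta>"
  shows "\<sigma> \<alpha> = \<beta>"
proof (rule psums_inject)
  show "psums (\<sigma> \<alpha>) = psums \<beta>"
  proof (rule set_eqI)
    fix x
    consider "x = 0" | "x = sum_list \<alpha>" | "x > sum_list \<alpha>" | "0 < x" "x < sum_list \<alpha>" by linarith
    then show "x \<in> psums (\<sigma> \<alpha>) \<longleftrightarrow> x \<in> psums \<beta>"
    proof cases
      case 2
      then show ?thesis
        using sum_list_in_psums[of \<beta>] sum_list_in_psums[of "\<sigma> \<alpha>"] assms by (simp add: sum_list_\<sigma>)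
    next
      case 3
      then show ?thesis
        using psums_le[of x \<beta>] psums_le[of x "\<sigma> \<alpha>"] assms by (auto simp: sum_list_\<sigma>)
    qed (simp_all add: assms(4))
  qed
qed (simp_all add: assms \<sigma>_in)

lemma \<sigma>_cases: "(\<forall>\<alpha>\<in>compositions. \<sigma> \<alpha> = \<alpha>) \<or> (\<forall>\<alpha>\<in>compositions. \<sigma> \<alpha> = comp_compl \<alpha>)"
proof (cases "1 \<in> psums (\<sigma> [1, 1])")
  case True
  have "\<sigma> \<alpha> = \<alpha>" if "\<alpha> \<in> compositions" for \<alpha>
    by (rule \<sigma>_eqI) (use that True in \<open>simp_all add: in_psums_\<sigma>\<close>)
  then show ?thesis by blast
next
  case False
  have "\<sigma> \<alpha> = comp_compl \<alpha>" if "\<alpha> \<in> compositions" for \<alpha>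
    by (rule \<sigma>_eqI) (use that False in \<open>simp_all add: in_psums_\<sigma> comp_compl\<close>)
  then show ?thesis by blast
qed

end

lemma graded_coalgebra_aut_permuting_fundamental_basis:
  assumes aut: "graded_coalgebra_aut \<Phi>" and perm: "\<Phi> ` fundamental_basis = fundamental_basis"
  shows "\<Phi> = id \<or> (\<forall>\<alpha>\<in>compositions. \<Phi> (fundamental_qsym \<alpha>) = fundamental_qsym (comp_compl \<alpha>))"
proof -
  have "\<forall>\<alpha>\<in>compositions. \<exists>\<beta>. \<beta> \<in> compositions \<and> \<Phi> (fundamental_qsym \<alpha>) = fundamental_qsym \<beta>"
    using perm unfolding fundamental_basis_def by blast
  from bchoice[OF this] obtain \<sigma> where \<sigma>_all:
    "\<forall>\<alpha>\<in>compositions. \<sigma> \<alpha> \<in> compositions \<and> \<Phi> (fundamental_qsym \<alpha>) = fundamental_qsym (\<sigma> \<alpha>)" ..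
  have \<sigma>: "\<sigma> \<alpha> \<in> compositions" "\<Phi> (fundamental_qsym \<alpha>) = fundamental_qsym (\<sigma> \<alpha>)"
    if "\<alpha> \<in> compositions" for \<alpha>
    using bspec[OF \<sigma>_all that] by simp_all
  interpret basis_permuting_aut \<Phi> \<sigma> by unfold_locales (use aut \<sigma> in auto)
  have "\<Phi> = id" if "\<forall>\<alpha>\<in>compositions. \<sigma> \<alpha> = \<alpha>"
    by (rule linear_eq_if_eq_on_fundamental[OF linear ratvec.linear_id]) (use that \<sigma> in simp)
  then show ?thesis using \<sigma>_cases \<sigma>(2) by auto
qed

theorem proposition5p4:
  shows "(\<exists>!\<Psi>. linearQ \<Psi> \<and> (\<forall>\<alpha>\<in>compositions. \<Psi> (fundamental_qsym \<alpha>) = fundamental_qsym (comp_compl \<alpha>)))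
    \<and> (\<forall>\<Psi>. linearQ \<Psi> \<and> (\<forall>\<alpha>\<in>compositions. \<Psi> (fundamental_qsym \<alpha>) = fundamental_qsym (comp_compl \<alpha>)) \<longrightarrow>
        graded_coalgebra_aut \<Psi> \<and> \<Psi> \<noteq> id \<and> \<Psi> ` fundamental_basis = fundamental_basis
        \<and> (\<forall>\<Phi>. graded_coalgebra_aut \<Phi> \<and> \<Phi> \<noteq> id \<and> \<Phi> ` fundamental_basis = fundamental_basis \<longrightarrow> \<Phi> = \<Psi>))"
proof (intro conjI allI impI)
  show "\<exists>!\<Psi>. linearQ \<Psi> \<and> (\<forall>\<alpha>\<in>compositions. \<Psi> (fundamental_qsym \<alpha>) = fundamental_qsym (comp_compl \<alpha>))"
    using complement_map_exists
  proof (rule ex_ex1I)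
    fix \<Psi> \<Psi>'
    assume "linearQ \<Psi> \<and> (\<forall>\<alpha>\<in>compositions. \<Psi> (fundamental_qsym \<alpha>) = fundamental_qsym (comp_compl \<alpha>))"
      and "linearQ \<Psi>' \<and> (\<forall>\<alpha>\<in>compositions. \<Psi>' (fundamental_qsym \<alpha>) = fundamental_qsym (comp_compl \<alpha>))"
    then show "\<Psi> = \<Psi>'" by (intro linear_eq_if_eq_on_fundamental) simp_all
  qed
next
  fix \<Psi>
  assume "linearQ \<Psi> \<and> (\<forall>\<alpha>\<in>compositions. \<Psi> (fundamental_qsym \<alpha>) = fundamental_qsym (comp_compl \<alpha>))"
  then have \<Psi>: "linearQ \<Psi>"
    "\<alpha> \<in> compositions \<Longrightarrow> \<Psi> (fundamental_qsym \<alpha>) = fundamental_qsym (comp_compl \<alpha>)" for \<alpha>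
    by blast+
  show "graded_coalgebra_aut \<Psi>" by (rule graded_coalgebra_aut_complement_map[OF \<Psi>])
  show "\<Psi> \<noteq> id" by (rule complement_map_neq_id[OF \<Psi>])
  show "\<Psi> ` fundamental_basis = fundamental_basis"
    by (rule complement_map_image_fundamental_basis[OF \<Psi>])
  fix \<Phi>
  assume \<Phi>: "graded_coalgebra_aut \<Phi> \<and> \<Phi> \<noteq> id \<and> \<Phi> ` fundamental_basis = fundamental_basis"
  then have "\<forall>\<alpha>\<in>compositions. \<Phi> (fundamental_qsym \<alpha>) = fundamental_qsym (comp_compl \<alpha>)"
    using graded_coalgebra_aut_permuting_fundamental_basis by blast
  moreover have "linearQ \<Phi>" using \<Phi> by (simp add: graded_coalgebra_aut_def coalgebra_hom_def)
  ultimately show "\<Phi> = \<Psi>" using \<Psi> by (intro linear_eq_if_eq_on_fundamental) simp_all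
qed

end
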